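(* For any prime number $p$, both operations $+_p$ and $\cdot_p$ (addition and multiplication of $p$-adic numbers), regarded as operations $X_p\times X_p\to X_p$ on the canonical encoding $X_p$ of $p$-adic numbers, are computable.
   Context: $\mathbb{N}_0=\{0,1,2,\dots\}$. **$p$-adic numbers.** Let $p$ be a prime and $P_p=\{0,1,\dots,p-1\}$. A $p$-adic number is a formal infinite linear combination $a=\sum_{n\ge k}a_np^n$ with $k\in\mathbb{Z}$, $k\le 0$ (the order of $a$), $n\in\mathbb{Z}$, $a_n\in P_p$, such that $a_k=0$ implies $k=0$; digits $a_n$ with $n<k$ are set to $0$. Two $p$-adic numbers are equal iff they have equal orders and equal digits at $p^n$ for every $n\in\mathbb{Z}$. $\mathbb{Q}_p$ is the set of $p$-adic numbers. The sum $a+_pb$ is obtained by term-wise addition of digits modulo $p$ with carries to higher powers of $p$; the order of the result is the minimum $j\le 0$ with nonzero digit at $p^j$ if such $j$ exists, and is $0$ otherwise. The product $a\cdot_p b$ is the usual product of $p$-adic numbers, obtained by distributivity with carries to higher powers. So $(\mathbb{Q}_p,+_p,\cdot_p)$ is the usual field of $p$-adic numbers. **Encodings and operations.** For a nonempty finite alphabet $A$ let $A^{\infty}=A^{\mathbb{N}_0}$ be the set of one-way infinite words $u_0u_1u_2\dots$ over $A$. An encoding is a nonempty subset $X\subset A^\infty$. An operation on $X$ is a map $F\colon X\times X\to X$. **Canonical encoding $X_p$.** Let $A=P_p\cup\{\xi\}$, where $\xi$ is a separation symbol. A $p$-adic number $a=\sum_{n\ge k}a_np^n$ of order $k$ is encoded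 as the word $u(a)\in A^\infty$ consisting of the binary digits of $|k|$ (least significant digit first; $0$ is written as the single digit $0$), then $\xi$, then the digits $a_k,a_{k+1},a_{k+2},\dots$ in this order. $X_p=\{u(a)\mid a\in\mathbb{Q}_p\}$, and $+_p,\cdot_p$ are transported to $X_p$ via the bijection $a\mapsto u(a)$. **Machines and computability.** A machine $M$ (for an encoding $X\subset A^\infty$) is a Turing machine with a finite set of states containing an initial state and a terminal state, and with a finite alphabet $A'\supset A\cup\{0,1,\epsilon\}$, where $\epsilon\in A'\setminus A$ is the empty cell symbol. It operates on three bi-infinite tapes $T_1,T_2,T_3$, with cells labeled by $\mathbb{Z}$, via corresponding heads $H_1,H_2,H_3$; $H_1,H_2$ only read, $H_3$ reads and writes. An input is a triple $(x,y,m)\in X\times X\times\mathbb{N}_0$: the word $x=x_0x_1\dots$ is stored on $T_1$ with $x_n$ in cell $n$ and $\epsilon$ in every cell $n<0$; $y$ is stored on $T_2$ in the same way; $m$ is stored in binary on $T_3$ with the least significant digit in cell $0$ and successive digits in cells $1,2,\dots$, all other cells containing $\epsilon$. The computation starts in the initial state with every head at cell $0$. In each step, if $M$ is in the terminal state the computation terminates; otherwise, depending only on the current state and the contents of the three currently scanned cells, $M$ rewrites the scanned cell of $T_3$, moves each head by $-1$, $0$ or $+1$, and passes to a new (possibly the same) state, according to its finite instruction table. An operation $F\colon X\times X\to X$ is computed by $M$ if for every input $(x,y,m)\in X^2\times\mathbb{N}_0$ the computation of $M$ terminates with $z_m$ in cell $0$ of $T_3$ and $\epsilon$ in all other cells of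 $T_3$, where $F(x,y)=z_0z_1z_2\dots$. $F$ is computable if some machine computes it. *)

theory Defs
  imports "HOL-Library.Omega_Words_Fun" "HOL-Computational_Algebra.Primes"
begin

text \<open>
  A formal sum \<open>\<Sum>n\<ge>k. a\<^sub>n p\<^sup>n\<close> is given by its order \<open>k\<close> and its digits \<open>a\<^sub>n\<close>,
  with \<open>n\<close> ranging over all integers. Record equality is equality of orders and of all digits.
\<close>

record padic =
  pord :: int
  pdigit :: "int \<Rightarrow> nat"

definition Qp :: "nat \<Rightarrow> padic set" where
  "Qp p = {a. pord a \<le> 0 \<and> (\<forall>n. pdigit a n < p) \<and> (\<forall>n < pord a. pdigit a n = 0) \<and>
              (pdigit a (pord a) = 0 \<longrightarrow> pord a = 0)}"

definition order_of_digits :: "(int \<Rightarrow> nat) \<Rightarrow> int" where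
  "order_of_digits d = (if \<exists>j\<le>0. d j \<noteq> 0 then LEAST j. j \<le> 0 \<and> d j \<noteq> 0 else 0)"

text \<open>
  \<open>carry p k t i\<close> is the carry into position \<open>k + i\<close> when the (not necessarily reduced)
  coefficients \<open>t\<close> are reduced modulo \<open>p\<close>, starting at position \<open>k\<close>.
\<close>

primrec carry :: "nat \<Rightarrow> int \<Rightarrow> (int \<Rightarrow> nat) \<Rightarrow> nat \<Rightarrow> nat" where
  "carry p k t 0 = 0"
| "carry p k t (Suc i) = (t (k + int i) + carry p k t i) div p"

definition reduced_digits :: "nat \<Rightarrow> int \<Rightarrow> (int \<Rightarrow> nat) \<Rightarrow> int \<Rightarrow> nat" where
  "reduced_digits p k t n = (if n < k then 0 else (t n + carry p k t (nat (n - k))) mod p)"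

definition padic_reduce :: "nat \<Rightarrow> int \<Rightarrow> (int \<Rightarrow> nat) \<Rightarrow> padic" where
  "padic_reduce p k t =
     \<lparr>pord = order_of_digits (reduced_digits p k t), pdigit = reduced_digits p k t\<rparr>"

definition padic_add :: "nat \<Rightarrow> padic \<Rightarrow> padic \<Rightarrow> padic" where
  "padic_add p a b =
     padic_reduce p (min (pord a) (pord b)) (\<lambda>n. pdigit a n + pdigit b n)"

definition padic_mult :: "nat \<Rightarrow> padic \<Rightarrow> padic \<Rightarrow> padic" where
  "padic_mult p a b =
     padic_reduce p (pord a + pord b)
       (\<lambda>n. \<Sum>i\<in>{pord a..n - pord b}. pdigit a i * pdigit b (n - i))"

lemma order_of_digits_props:
  assumes "\<And>n. n < k \<Longrightarrow> d n = 0"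
  shows "order_of_digits d \<le> 0" "\<And>n. n < order_of_digits d \<Longrightarrow> d n = 0"
    "d (order_of_digits d) = 0 \<Longrightarrow> order_of_digits d = 0"
proof -
  have main: "order_of_digits d \<le> 0 \<and> (\<forall>n. n < order_of_digits d \<longrightarrow> d n = 0) \<and>
              (d (order_of_digits d) = 0 \<longrightarrow> order_of_digits d = 0)"
  proof (cases "\<exists>j\<le>0. d j \<noteq> 0")
    case False
    then show ?thesis by (auto simp: order_of_digits_def)
  next
    case True
    define P where "P j \<longleftrightarrow> j \<le> 0 \<and> d j \<noteq> 0" for j
    obtain j0 where "P j0" using True by (auto simp: P_def)
    moreover have low: "k \<le> j" if "P j" for j
      using assms[of j] that by (force simp: P_def)
    ultimately have ex: "\<exists>i. P (k + int i)"
      by (intro exI[of _ "nat (j0 - k)"]) simp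
    define m where "m = k + int (LEAST i. P (k + int i))"
    have Pm: "P m" unfolding m_def using ex by (rule LeastI_ex)
    have min: "m \<le> j" if "P j" for j
      using Least_le[of "\<lambda>i. P (k + int i)" "nat (j - k)"] that low[OF that]
      by (simp add: m_def)
    have "(LEAST j. P j) = m" using Pm min by (rule Least_equality)
    then have eq: "order_of_digits d = m"
      using True by (simp add: order_of_digits_def P_def)
    have "d n = 0" if "n < m" for n
      using min[of n] Pm that by (auto simp: P_def)
    then show ?thesis unfolding eq using Pm by (auto simp: P_def)
  qed
  then show "order_of_digits d \<le> 0" "\<And>n. n < order_of_digits d \<Longrightarrow> d n = 0"
    "d (order_of_digits d) = 0 \<Longrightarrow> order_of_digits d = 0" by blast+
qed

lemma padic_reduce_in_Qp:
  assumes "0 < p" shows "padic_reduce p k t \<in> Qp p"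
proof -
  have z: "\<And>n. n < k \<Longrightarrow> reduced_digits p k t n = 0"
    by (simp add: reduced_digits_def)
  from order_of_digits_props[of k, OF z] show ?thesis
    using assms by (auto simp: padic_reduce_def Qp_def) (simp add: reduced_digits_def)
qed

lemma padic_add_in_Qp: "0 < p \<Longrightarrow> padic_add p a b \<in> Qp p"
  and padic_mult_in_Qp: "0 < p \<Longrightarrow> padic_mult p a b \<in> Qp p"
  by (simp_all add: padic_add_def padic_mult_def padic_reduce_in_Qp)

text \<open>
  A fixed countable supply of symbols from which all finite alphabets are drawn: \<open>Digit d\<close> is the
  digit \<open>d\<close> (in particular \<open>Digit 0\<close> and \<open>Digit 1\<close> are the symbols \<open>0\<close> and \<open>1\<close>), \<open>Sep\<close> is \<open>\<xi>\<close>,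
  \<open>Blank\<close> is the empty cell symbol \<open>\<epsilon>\<close>, and \<open>Aux i\<close> are further symbols a machine may use.
\<close>

datatype symbol = Digit nat | Sep | Blank | Aux nat

definition words :: "symbol set \<Rightarrow> symbol word set" where
  "words A = {u. range u \<subseteq> A}"

definition encoding :: "symbol set \<Rightarrow> symbol word set \<Rightarrow> bool" where
  "encoding A X \<longleftrightarrow> finite A \<and> A \<noteq> {} \<and> X \<noteq> {} \<and> X \<subseteq> words A"

definition operation_on :: "symbol word set \<Rightarrow> (symbol word \<Rightarrow> symbol word \<Rightarrow> symbol word) \<Rightarrow> bool" where
  "operation_on X F \<longleftrightarrow> (\<forall>x\<in>X. \<forall>y\<in>X. F x y \<in> X)"

text \<open>Binary digits, least significant first; \<open>0\<close> is written as the single digit \<open>0\<close>.\<close>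

fun binary_digits :: "nat \<Rightarrow> nat list" where
  "binary_digits n = (if n < 2 then [n] else n mod 2 # binary_digits (n div 2))"

declare binary_digits.simps [simp del]

definition binary :: "nat \<Rightarrow> symbol list" where
  "binary n = map Digit (binary_digits n)"

definition padic_alphabet :: "nat \<Rightarrow> symbol set" where
  "padic_alphabet p = insert Sep (Digit ` {0..<p})"

definition padic_word :: "padic \<Rightarrow> symbol word" where
  "padic_word a = (binary (nat \<bar>pord a\<bar>) @ [Sep]) \<frown> (\<lambda>i. Digit (pdigit a (pord a + int i)))"

definition Xp :: "nat \<Rightarrow> symbol word set" where
  "Xp p = padic_word ` Qp p"

definition transport ::
    "nat \<Rightarrow> (padic \<Rightarrow> padic \<Rightarrow> padic) \<Rightarrow> symbol word \<Rightarrow> symbol word \<Rightarrow> symbol word" where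
  "transport p f x y =
     padic_word (f (inv_into (Qp p) padic_word x) (inv_into (Qp p) padic_word y))"

lemma binary_digits_less_2: "d \<in> set (binary_digits n) \<Longrightarrow> d < 2"
proof (induction n rule: binary_digits.induct)
  case (1 n)
  then show ?case
    by (cases "n < 2") (auto simp: binary_digits.simps[of n])
qed

lemma inj_binary_digits: "binary_digits m = binary_digits n \<Longrightarrow> m = n"
proof -
  define val where "val xs = foldr (\<lambda>d s. d + 2 * s) xs 0" for xs :: "nat list"
  have "val (binary_digits n) = n" for n
  proof (induction n rule: binary_digits.induct)
    case (1 n)
    then show ?case
      by (cases "n < 2") (simp_all add: binary_digits.simps[of n] val_def)
  qed
  then show "binary_digits m = binary_digits n \<Longrightarrow> m = n" by metis
qed

lemma Sep_prefix_unique: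
  assumes "(xs @ [Sep]) \<frown> u = (ys @ [Sep]) \<frown> v" "Sep \<notin> set xs" "Sep \<notin> set ys"
  shows "xs = ys \<and> u = v"
  using assms
proof (induction xs arbitrary: ys)
  case Nil
  show ?case
  proof (cases ys)
    case Nil
    have "u i = v i" for i
      using fun_cong[OF Nil.prems(1), of "Suc i"] Nil by (simp add: conc_def)
    then show ?thesis using Nil by auto
  next
    case (Cons y ys')
    have "Sep = y" using fun_cong[OF Nil.prems(1), of 0] Cons by (simp add: conc_def)
    then show ?thesis using Nil.prems Cons by simp
  qed
next
  case (Cons x xs)
  show ?case
  proof (cases ys)
    case Nil
    have "x = Sep" using fun_cong[OF Cons.prems(1), of 0] Nil by (simp add: conc_def)
    then show ?thesis using Cons.prems by simp
  next
    case (Cons y ys')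
    have "x = y" using fun_cong[OF Cons.prems(1), of 0] Cons by (simp add: conc_def)
    moreover have "(xs @ [Sep]) \<frown> u = (ys' @ [Sep]) \<frown> v"
    proof (rule ext)
      fix n show "((xs @ [Sep]) \<frown> u) n = ((ys' @ [Sep]) \<frown> v) n"
        using fun_cong[OF Cons.prems(1), of "Suc n"] Cons by (auto simp: conc_def split: if_splits)
    qed
    ultimately show ?thesis using Cons.IH[of ys'] Cons.prems Cons by simp
  qed
qed

lemma inj_on_padic_word: "inj_on padic_word (Qp p)"
proof
  fix a b assume a: "a \<in> Qp p" and b: "b \<in> Qp p" and eq: "padic_word a = padic_word b"
  have *: "binary (nat \<bar>pord a\<bar>) = binary (nat \<bar>pord b\<bar>) \<and>
        (\<lambda>i. Digit (pdigit a (pord a + int i))) = (\<lambda>i. Digit (pdigit b (pord b + int i)))"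
    using eq unfolding padic_word_def
    by (rule Sep_prefix_unique) (auto simp: binary_def)
  then have "nat \<bar>pord a\<bar> = nat \<bar>pord b\<bar>"
    by (intro inj_binary_digits) (simp add: binary_def inj_map_eq_map inj_def)
  then have o: "pord a = pord b" using a b by (auto simp: Qp_def)
  have "pdigit a n = pdigit b n" for n
  proof (cases "n < pord a")
    case True
    then show ?thesis using a b o by (simp add: Qp_def)
  next
    case False
    have "Digit (pdigit a (pord a + int (nat (n - pord a)))) =
          Digit (pdigit b (pord b + int (nat (n - pord a))))"
      using * by meson
    then show ?thesis using False o by simp
  qed
  then have "pdigit a = pdigit b" by (rule ext)
  then show "a = b" using o by (cases a; cases b) simp
qed

lemma bij_betw_padic_word: "bij_betw padic_word (Qp p) (Xp p)"
  by (simp add: bij_betw_def inj_on_padic_word Xp_def)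

lemma encoding_Xp:
  assumes "2 \<le> p" shows "encoding (padic_alphabet p) (Xp p)"
proof -
  have "padic_word a i \<in> padic_alphabet p" if "a \<in> Qp p" for a i
  proof -
    have "set (binary n) \<subseteq> padic_alphabet p" for n
      using assms binary_digits_less_2[of _ n] by (force simp: binary_def padic_alphabet_def)
    then have "set (binary n @ [Sep]) \<subseteq> padic_alphabet p" for n
      by (simp add: padic_alphabet_def)
    then show ?thesis using that
      unfolding padic_word_def conc_def
      by (smt (verit) Qp_def atLeastLessThan_iff imageI insertCI mem_Collect_eq nth_mem
          padic_alphabet_def subsetD zero_le)
  qed
  moreover have "padic_add p undefined undefined \<in> Qp p"
    using assms by (simp add: padic_add_in_Qp)
  ultimately show ?thesis
    by (auto simp: encoding_def words_def Xp_def padic_alphabet_def)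
qed

lemma operation_on_Xp:
  assumes "0 < p"
  shows "operation_on (Xp p) (transport p (padic_add p))"
    and "operation_on (Xp p) (transport p (padic_mult p))"
  using assms by (auto simp: operation_on_def Xp_def transport_def padic_add_in_Qp padic_mult_in_Qp)

text \<open>
  \<open>delta q s\<^sub>1 s\<^sub>2 s\<^sub>3\<close> is the instruction for state \<open>q\<close> and scanned symbols \<open>s\<^sub>1, s\<^sub>2, s\<^sub>3\<close>: the new
  state, the symbol written on the third tape, and the moves of the three heads.
  Only finitely many of its values matter, those for states and symbols of the machine.
\<close>

record 'q machine =
  states :: "'q set"
  initial :: 'q
  terminal :: 'q
  tape_symbols :: "symbol set"
  delta :: "'q \<Rightarrow> symbol \<Rightarrow> symbol \<Rightarrow> symbol \<Rightarrow> 'q \<times> symbol \<times> int \<times> int \<times> int"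

definition machine_over :: "symbol set \<Rightarrow> 'q machine \<Rightarrow> bool" where
  "machine_over A M \<longleftrightarrow>
     finite (states M) \<and> initial M \<in> states M \<and> terminal M \<in> states M \<and>
     finite (tape_symbols M) \<and> A \<union> {Digit 0, Digit 1, Blank} \<subseteq> tape_symbols M \<and> Blank \<notin> A \<and>
     (\<forall>q \<in> states M - {terminal M}.
      \<forall>s1 \<in> tape_symbols M. \<forall>s2 \<in> tape_symbols M. \<forall>s3 \<in> tape_symbols M.
        delta M q s1 s2 s3 \<in>
          states M \<times> tape_symbols M \<times> {-1, 0, 1} \<times> {-1, 0, 1} \<times> {-1, 0, 1})"

text \<open>The contents of the first two tapes never change, so they are not part of a configuration.\<close>

record 'q config =
  state :: 'q
  head1 :: int
  head2 :: int
  head3 :: int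
  tape3 :: "int \<Rightarrow> symbol"

definition word_tape :: "symbol word \<Rightarrow> int \<Rightarrow> symbol" where
  "word_tape x n = (if n < 0 then Blank else x (nat n))"

definition list_tape :: "symbol list \<Rightarrow> int \<Rightarrow> symbol" where
  "list_tape xs n = (if 0 \<le> n \<and> n < int (length xs) then xs ! nat n else Blank)"

definition init_config :: "'q machine \<Rightarrow> nat \<Rightarrow> 'q config" where
  "init_config M m =
     \<lparr>state = initial M, head1 = 0, head2 = 0, head3 = 0, tape3 = list_tape (binary m)\<rparr>"

definition step :: "'q machine \<Rightarrow> symbol word \<Rightarrow> symbol word \<Rightarrow> 'q config \<Rightarrow> 'q config" where
  "step M x y c =
     (if state c = terminal M then c
      else case delta M (state c) (word_tape x (head1 c)) (word_tape y (head2 c)) (tape3 c (head3 c))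
        of (q, s, d1, d2, d3) \<Rightarrow>
          \<lparr>state = q, head1 = head1 c + d1, head2 = head2 c + d2, head3 = head3 c + d3,
           tape3 = (tape3 c)(head3 c := s)\<rparr>)"

definition terminates_with ::
    "'q machine \<Rightarrow> symbol word \<Rightarrow> symbol word \<Rightarrow> nat \<Rightarrow> (int \<Rightarrow> symbol) \<Rightarrow> bool" where
  "terminates_with M x y m T \<longleftrightarrow>
     (\<exists>n. let c = (step M x y ^^ n) (init_config M m) in state c = terminal M \<and> tape3 c = T)"

definition computes ::
    "'q machine \<Rightarrow> symbol word set \<Rightarrow> (symbol word \<Rightarrow> symbol word \<Rightarrow> symbol word) \<Rightarrow> bool" where
  "computes M X F \<longleftrightarrow>
     (\<forall>x\<in>X. \<forall>y\<in>X. \<forall>m. terminates_with M x y m ((\<lambda>_. Blank)(0 := F x y m)))"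

text \<open>As the state set is finite, it is no restriction to take states to be natural numbers.\<close>

definition computable_operation ::
    "symbol set \<Rightarrow> symbol word set \<Rightarrow> (symbol word \<Rightarrow> symbol word \<Rightarrow> symbol word) \<Rightarrow> bool" where
  "computable_operation A X F \<longleftrightarrow>
     encoding A X \<and> operation_on X F \<and> (\<exists>M :: nat machine. machine_over A M \<and> computes M X F)"

end

theory Submission
  imports Defs "HOL-Library.Countable" "HOL-Library.Nat_Bijection"
begin

text \<open>
  Since no bound on the running time is asked for, the machine may be as slow as one likes, and the
  proof separates what is computed from how a machine computes it.

  What is computed: write both operands with digits counted from their orders. If \<open>-K\<close> is the
  position where the unreduced sum or product starts and \<open>T i\<close> is its coefficient at \<open>p\<close> to the power
  \<open>i - K\<close>, then the carries are defined by recursion, \<open>c (Suc i) = (T i + c i) div p\<close>, the reduced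
  digits are \<open>D i = (T i + c i) mod p\<close>, the order of the result is \<open>J - K\<close> for the least \<open>J\<close> with
  \<open>D J \<noteq> 0\<close> or \<open>K \<le> J\<close>, and the required letter is a binary digit of \<open>K - J\<close>, the separator, or a
  digit \<open>D (J + i)\<close>. All of this arises from the letters of the two words and the binary index by
  primitive recursion and by searches that are known to succeed
  (\<open>evaluable_padic_add\<close>, \<open>evaluable_padic_mult\<close>). The orders of the operands and the index are
  themselves found by searching for the end of a binary numeral and summing up its digits.

  How it is computed: functions with this closure property (\<open>evaluable\<close>) are computed by programs
  of a small while language on registers, which can compare the letter at the position given by a
  register. One machine executes such a program (\<open>sim_step\<close>). A register with value \<open>v\<close> is
  stored as a mark in cell \<open>v\<close> of the third tape, next to the original letter of that cell, and the
  three heads always move together: to execute a command the machine walks right to the mark of the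
  register in question, so that all three heads scan position \<open>v\<close> of their tapes, acts there, and
  walks back to the origin, which is recognised by the mark of a register that always is \<open>0\<close>. The
  control state holds the stack of commands still to be executed, and only finitely many stacks
  occur. As cells without marks keep their original letter, setting all registers to \<open>0\<close> and erasing
  the index leaves a tape that is blank outside the origin, as required on termination
  (\<open>computable_if_evaluable\<close>).
\<close>

section \<open>A while language on registers\<close>

text \<open>
  A program works on registers, on two words that it only reads, and on a third word, initially the
  binary index, whose letters it can also erase. A test refers to a register: it asks whether
  the register is \<open>0\<close>, or for the letter of one of the three words at the position in the register.
  Tests are syntax rather than predicates so that programs form a countable type.
\<close>

instance symbol :: countable by countable_datatype

datatype test = IsZero | Sym1 symbol | Sym2 symbol | Sym3 symbol

primrec holds :: "test \<Rightarrow> symbol \<Rightarrow> symbol \<Rightarrow> symbol \<Rightarrow> bool \<Rightarrow> bool" where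
  "holds IsZero a b v zero \<longleftrightarrow> zero"
| "holds (Sym1 c) a b v zero \<longleftrightarrow> a = c"
| "holds (Sym2 c) a b v zero \<longleftrightarrow> b = c"
| "holds (Sym3 c) a b v zero \<longleftrightarrow> v = c"

datatype com = Skip | Inc nat | Dec nat | Erase nat | Halt symbol
  | Seq com com | Cond nat test com com | While nat com

instance test :: countable by countable_datatype
instance com :: countable by countable_datatype

text \<open>
  A configuration consists of the stack of commands still to be executed, the registers and the
  third word. There is no rule for \<open>Halt\<close>: a computation that reaches it is complete, and its
  argument is the output.
\<close>

inductive exec :: "symbol word \<Rightarrow> symbol word \<Rightarrow>
    com list \<times> (nat \<Rightarrow> nat) \<times> symbol word \<Rightarrow> com list \<times> (nat \<Rightarrow> nat) \<times> symbol word \<Rightarrow> bool"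
  for x y where
  "exec x y (Skip # ks, s, w) (ks, s, w)"
| "exec x y (Inc r # ks, s, w) (ks, s(r := Suc (s r)), w)"
| "exec x y (Dec r # ks, s, w) (ks, s(r := s r - 1), w)"
| "exec x y (Erase r # ks, s, w) (ks, s, w(s r := Blank))"
| "exec x y (Seq c1 c2 # ks, s, w) (c1 # c2 # ks, s, w)"
| "exec x y (Cond r t c1 c2 # ks, s, w)
     ((if holds t (x (s r)) (y (s r)) (w (s r)) (s r = 0) then c1 else c2) # ks, s, w)"
| "exec x y (While r c # ks, s, w) (if s r = 0 then ks else c # While r c # ks, s, w)"

primrec registers :: "com \<Rightarrow> nat set" where
  "registers Skip = {}"
| "registers (Inc r) = {r}"
| "registers (Dec r) = {r}"
| "registers (Erase r) = {r}"
| "registers (Halt a) = {}"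
| "registers (Seq c1 c2) = registers c1 \<union> registers c2"
| "registers (Cond r t c1 c2) = insert r (registers c1 \<union> registers c2)"
| "registers (While r c) = insert r (registers c)"

lemma finite_registers [simp]: "finite (registers c)"
  by (induction c) auto

text \<open>
  The stacks that can occur while \<open>c\<close> is executed on top of \<open>ks\<close>, before \<open>ks\<close> itself is reached.
  They will be part of the control states of a machine, so it matters that there are
  finitely many: a loop puts itself back below its body, hence recreates the same stacks.
\<close>

primrec stacks :: "com \<Rightarrow> com list \<Rightarrow> com list set" where
  "stacks Skip ks = {Skip # ks}"
| "stacks (Inc r) ks = {Inc r # ks}"
| "stacks (Dec r) ks = {Dec r # ks}"
| "stacks (Erase r) ks = {Erase r # ks}"
| "stacks (Halt a) ks = {Halt a # ks}"
| "stacks (Seq c1 c2) ks = insert (Seq c1 c2 # ks) (stacks c1 (c2 # ks) \<union> stacks c2 ks)"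
| "stacks (Cond r t c1 c2) ks = insert (Cond r t c1 c2 # ks) (stacks c1 ks \<union> stacks c2 ks)"
| "stacks (While r c) ks = insert (While r c # ks) (stacks c (While r c # ks))"

lemma finite_stacks: "finite (stacks c ks)"
  by (induction c arbitrary: ks) auto

lemma stacks_self: "c # ks \<in> stacks c ks"
  by (cases c) auto

lemma stacks_step:
  assumes "exec x y (st, s, w) (st', s', w')" "st \<in> stacks c ks"
  shows "st' \<in> insert ks (stacks c ks)"
  using assms(2)
proof (induction c arbitrary: ks)
  case (Seq c1 c2)
  then consider "st = Seq c1 c2 # ks" | "st \<in> stacks c1 (c2 # ks)" | "st \<in> stacks c2 ks" by auto
  then show ?case
  proof cases
    case 1
    then show ?thesis using assms(1) stacks_self by (auto elim!: exec.cases)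
  next
    case 2
    then show ?thesis using Seq.IH(1)[of "c2 # ks"] stacks_self by auto
  next
    case 3
    then show ?thesis using Seq.IH(2)[of ks] by auto
  qed
next
  case (Cond r t c1 c2)
  then consider "st = Cond r t c1 c2 # ks" | "st \<in> stacks c1 ks" | "st \<in> stacks c2 ks" by auto
  then show ?case
  proof cases
    case 1
    then show ?thesis using assms(1) stacks_self by (auto elim!: exec.cases split: if_splits)
  next
    case 2
    then show ?thesis using Cond.IH(1)[of ks] by auto
  next
    case 3
    then show ?thesis using Cond.IH(2)[of ks] by auto
  qed
next
  case (While r c)
  then consider "st = While r c # ks" | "st \<in> stacks c (While r c # ks)" by auto
  then show ?case
  proof cases
    case 1
    then show ?thesis using assms(1) stacks_self by (auto elim!: exec.cases split: if_splits)
  next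
    case 2
    then show ?thesis using While.IH[of "While r c # ks"] by auto
  qed
qed (use assms(1) in \<open>auto elim!: exec.cases\<close>)

lemma stacks_registers:
  "st \<in> stacks c ks \<Longrightarrow> \<Union> (registers ` set st) \<subseteq> registers c \<union> \<Union> (registers ` set ks)"
  by (induction c arbitrary: ks) (fastforce+)

section \<open>Executing programs on a machine\<close>

text \<open>
  A cell carries a letter and the set of registers whose value is the number of the cell. A cell
  without marks looks exactly like a plain letter: a tape is blank where there is neither a
  letter nor a mark, although infinitely many cells are blank, and no cleaning up is needed.
\<close>

definition cell :: "symbol \<Rightarrow> nat set \<Rightarrow> symbol" where
  "cell v S = (if S = {} then v else Aux (to_nat (v, set_encode S)))"

text \<open>The letters of the third word: binary digits until they are erased.\<close>

definition index_symbols :: "symbol set" where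
  "index_symbols = {Digit 0, Digit 1, Blank}"

primrec contents :: "symbol \<Rightarrow> symbol \<times> nat set" where
  "contents (Digit d) = (Digit d, {})"
| "contents Sep = (Sep, {})"
| "contents Blank = (Blank, {})"
| "contents (Aux n) = (case from_nat n of (v, k) \<Rightarrow> (v, set_decode k))"

lemma contents_cell [simp]: "v \<in> index_symbols \<Longrightarrow> finite S \<Longrightarrow> contents (cell v S) = (v, S)"
  by (auto simp: cell_def index_symbols_def)

text \<open>
  \<open>Seek st\<close> walks right to the mark needed for the top command of \<open>st\<close>; \<open>Put r st\<close> places the mark
  of \<open>r\<close>, which has been removed from a neighbouring cell; \<open>Back st\<close> walks left to the origin.
\<close>

datatype ctrl = Start | Seek "com list" | Put nat "com list" | Back "com list" | Done

instance ctrl :: countable by countable_datatype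

text \<open>
  The register whose mark a command needs. Here and below \<open>z\<close> is a register above those of the
  program: it remains \<open>0\<close> and its mark identifies the origin. Commands that need no register
  are executed at the origin.
\<close>

fun target :: "nat \<Rightarrow> com \<Rightarrow> nat" where
  "target z (Inc r) = r"
| "target z (Dec r) = r"
| "target z (Erase r) = r"
| "target z (Cond r t c1 c2) = r"
| "target z (While r c) = r"
| "target z c = z"

text \<open>
  What happens once the mark is found in a cell with letter \<open>v\<close> and marks \<open>S\<close>, where \<open>a\<close> and \<open>b\<close> are
  the letters on the other two tapes. As \<open>z\<close> marks the origin, \<open>z \<in> S\<close> says that the register found
  is \<open>0\<close>.
\<close>

fun act :: "nat \<Rightarrow> com \<Rightarrow> com list \<Rightarrow> symbol \<Rightarrow> symbol \<Rightarrow> symbol \<Rightarrow> nat set \<Rightarrow> ctrl \<times> symbol \<times> int" where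
  "act z Skip ks a b v S = (Back ks, cell v S, 0)"
| "act z (Inc r) ks a b v S = (Put r ks, cell v (S - {r}), 1)"
| "act z (Dec r) ks a b v S =
     (if z \<in> S then (Back ks, cell v S, 0) else (Put r ks, cell v (S - {r}), -1))"
| "act z (Erase r) ks a b v S = (Back ks, cell Blank S, 0)"
| "act z (Halt e) ks a b v S = (Done, e, 0)"
| "act z (Seq c1 c2) ks a b v S = (Back (c1 # c2 # ks), cell v S, 0)"
| "act z (Cond r t c1 c2) ks a b v S =
     (Back ((if holds t a b v (z \<in> S) then c1 else c2) # ks), cell v S, 0)"
| "act z (While r c) ks a b v S =
     (Back (if z \<in> S then ks else c # While r c # ks), cell v S, 0)"

text \<open>
  The result is a control state, a symbol for the third tape and one direction for all three heads.
  In the beginning all registers are \<open>0\<close>, so their marks go to the cell where the heads are.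
\<close>

fun move :: "nat \<Rightarrow> com \<Rightarrow> ctrl \<Rightarrow> symbol \<Rightarrow> symbol \<Rightarrow> symbol \<Rightarrow> ctrl \<times> symbol \<times> int" where
  "move z c0 Start a b e = (Seek [c0], cell e {..z}, 0)"
| "move z c0 (Seek []) a b e = (Done, e, 0)"
| "move z c0 (Seek (c # ks)) a b e =
     (if target z c \<in> snd (contents e) then act z c ks a b (fst (contents e)) (snd (contents e))
      else (Seek (c # ks), e, 1))"
| "move z c0 (Put r ks) a b e =
     (Back ks, cell (fst (contents e)) (insert r (snd (contents e))), 0)"
| "move z c0 (Back ks) a b e =
     (if z \<in> snd (contents e) then (Seek ks, e, 0) else (Back ks, e, -1))"
| "move z c0 Done a b e = (Done, e, 0)"

abbreviation program_stacks :: "com \<Rightarrow> com list set" where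
  "program_stacks c \<equiv> insert [] (stacks c [])"

definition ctrl_states :: "nat \<Rightarrow> com \<Rightarrow> ctrl set" where
  "ctrl_states z c0 = {Start, Done} \<union> Seek ` program_stacks c0 \<union> Back ` program_stacks c0 \<union>
     (\<lambda>(r, ks). Put r ks) ` ({..z} \<times> program_stacks c0)"

definition ctrl_symbols :: "symbol set \<Rightarrow> nat \<Rightarrow> symbol set" where
  "ctrl_symbols A z =
     A \<union> index_symbols \<union> (\<lambda>(v, S). cell v S) ` (index_symbols \<times> Pow {..z})"

text \<open>
  The transition function is total, but a machine has to stay within its finite sets of states and
  symbols; the default for impossible situations ensures this trivially, and correctness amounts to
  never leaving these sets.
\<close>

definition simulator :: "symbol set \<Rightarrow> nat \<Rightarrow> com \<Rightarrow> ctrl machine" where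
  "simulator A z c0 =
     \<lparr>states = ctrl_states z c0, initial = Start, terminal = Done,
      tape_symbols = ctrl_symbols A z,
      delta = (\<lambda>q a b e. case move z c0 q a b e of (q', e', d) \<Rightarrow>
        if q' \<in> ctrl_states z c0 \<and> e' \<in> ctrl_symbols A z then (q', e', d, d, d)
        else (Done, Blank, 0, 0, 0))\<rparr>"

lemma move_dir: "snd (snd (move z c0 q a b e)) \<in> {-1, 0, 1}"
proof -
  have "snd (snd (act z c ks a b v S)) \<in> {-1, 0, 1}" for c ks v S
    by (cases c) auto
  then show ?thesis
    by (cases "(z, c0, q, a, b, e)" rule: move.cases) (auto simp del: insert_iff simp: insertI1)
qed

lemma machine_over_simulator:
  assumes "finite A" "Blank \<notin> A"
  shows "machine_over A (simulator A z c0)"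
proof -
  have "finite (ctrl_states z c0)"
    by (auto simp: ctrl_states_def finite_stacks)
  moreover have "finite (ctrl_symbols A z)"
    using assms by (auto simp: ctrl_symbols_def index_symbols_def)
  moreover have "delta (simulator A z c0) q a b e
      \<in> ctrl_states z c0 \<times> ctrl_symbols A z \<times> {-1, 0, 1} \<times> {-1, 0, 1} \<times> {-1, 0, 1}" for q a b e
  proof -
    obtain q' e' d where m: "move z c0 q a b e = (q', e', d)" by (rule prod_cases3)
    have "Done \<in> ctrl_states z c0" "Blank \<in> ctrl_symbols A z"
      by (auto simp: ctrl_states_def ctrl_symbols_def index_symbols_def)
    moreover define D where "D = {-1, 0, 1 :: int}"
    moreover have "d \<in> D" "0 \<in> D"
      using move_dir[of z c0 q a b e] by (simp_all add: m D_def)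
    ultimately show ?thesis
      unfolding D_def[symmetric] by (simp add: simulator_def m)
  qed
  moreover have "Start \<in> ctrl_states z c0" "Done \<in> ctrl_states z c0"
    "A \<union> {Digit 0, Digit 1, Blank} \<subseteq> ctrl_symbols A z"
    by (auto simp: ctrl_states_def ctrl_symbols_def index_symbols_def)
  ultimately show ?thesis
    using assms unfolding machine_over_def by (simp add: simulator_def)
qed

text \<open>
  The third tape when exactly the marks of the registers in \<open>R\<close> are present. The set is \<open>{..z}\<close>
  except between the removal of a mark and its return in the neighbouring cell.
\<close>

definition tape :: "nat set \<Rightarrow> (nat \<Rightarrow> nat) \<Rightarrow> symbol word \<Rightarrow> int \<Rightarrow> symbol" where
  "tape R s w i = (if i < 0 then Blank else cell (w (nat i)) {r \<in> R. s r = nat i})"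

definition conf :: "ctrl \<Rightarrow> nat \<Rightarrow> (int \<Rightarrow> symbol) \<Rightarrow> ctrl config" where
  "conf q h T = \<lparr>state = q, head1 = int h, head2 = int h, head3 = int h, tape3 = T\<rparr>"

definition reach :: "'q machine \<Rightarrow> symbol word \<Rightarrow> symbol word \<Rightarrow> 'q config \<Rightarrow> 'q config \<Rightarrow> bool" where
  "reach M x y c c' \<longleftrightarrow> (\<exists>n. (step M x y ^^ n) c = c')"

lemma reach_refl: "reach M x y c c"
  unfolding reach_def by (rule exI[of _ 0]) simp

lemma reach_step: "reach M x y (step M x y c) c' \<Longrightarrow> reach M x y c c'"
  unfolding reach_def by (metis funpow_Suc_right comp_apply)

lemma reach_trans: "reach M x y c c' \<Longrightarrow> reach M x y c' c'' \<Longrightarrow> reach M x y c c''"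
proof -
  assume "reach M x y c c'" "reach M x y c' c''"
  then obtain m n where "(step M x y ^^ m) c = c'" "(step M x y ^^ n) c' = c''"
    by (auto simp: reach_def)
  then have "(step M x y ^^ (n + m)) c = c''" by (simp add: funpow_add)
  then show "reach M x y c c''" unfolding reach_def ..
qed

lemma step_conf:
  assumes "move z c0 q (x h) (y h) (T (int h)) = (q', e', d)" "q \<noteq> Done"
    "q' \<in> ctrl_states z c0" "e' \<in> ctrl_symbols A z" "int h + d = int h'"
  shows "step (simulator A z c0) x y (conf q h T) = conf q' h' (T(int h := e'))"
  using assms by (simp add: step_def conf_def simulator_def word_tape_def)

lemma step_conf_read:
  assumes "move z c0 q (x h) (y h) (T (int h)) = (q', T (int h), d)" "q \<noteq> Done"
    "q' \<in> ctrl_states z c0" "T (int h) \<in> ctrl_symbols A z" "int h + d = int h'"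
  shows "step (simulator A z c0) x y (conf q h T) = conf q' h' T"
  using step_conf[where T = T and x = x and y = y, OF assms] by simp

lemma cell_symbol: "v \<in> index_symbols \<Longrightarrow> S \<subseteq> {..z} \<Longrightarrow> cell v S \<in> ctrl_symbols A z"
  by (auto simp: ctrl_symbols_def)

lemma ctrl_states_members: "Start \<in> ctrl_states z c0" "Done \<in> ctrl_states z c0"
  "ks \<in> program_stacks c0 \<Longrightarrow> Seek ks \<in> ctrl_states z c0"
  "ks \<in> program_stacks c0 \<Longrightarrow> Back ks \<in> ctrl_states z c0"
  "ks \<in> program_stacks c0 \<Longrightarrow> r \<le> z \<Longrightarrow> Put r ks \<in> ctrl_states z c0"
  by (auto simp: ctrl_states_def)

lemma tape_int [simp]: "tape R s w (int h) = cell (w h) {r \<in> R. s r = h}"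
  by (simp add: tape_def)

lemma contents_tape:
  assumes "range w \<subseteq> index_symbols" "finite R"
  shows "contents (tape R s w (int h)) = (w h, {r \<in> R. s r = h})"
  using assms by (subst tape_int, subst contents_cell) auto

lemma tape_symbol:
  assumes "range w \<subseteq> index_symbols" "R \<subseteq> {..z}"
  shows "tape R s w (int h) \<in> ctrl_symbols A z"
  unfolding tape_int by (rule cell_symbol) (use assms in auto)

lemma reach_Back:
  assumes "ks \<in> program_stacks c0" "range w \<subseteq> index_symbols" "s z = 0"
  shows "reach (simulator A z c0) x y (conf (Back ks) h (tape {..z} s w))
    (conf (Seek ks) 0 (tape {..z} s w))"
proof (induction h)
  case 0
  have "step (simulator A z c0) x y (conf (Back ks) 0 (tape {..z} s w)) = conf (Seek ks) 0 (tape {..z} s w)"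
  proof (rule step_conf_read)
    show "move z c0 (Back ks) (x 0) (y 0) (tape {..z} s w (int 0)) =
        (Seek ks, tape {..z} s w (int 0), 0)"
      using assms by (simp add: contents_tape del: tape_int of_nat_0)
    show "Seek ks \<in> ctrl_states z c0" using assms(1) by (rule ctrl_states_members)
    show "tape {..z} s w (int 0) \<in> ctrl_symbols A z" using assms(2) by (rule tape_symbol) simp
  qed auto
  then show ?case by - (rule reach_step, simp add: reach_refl)
next
  case (Suc h)
  have "step (simulator A z c0) x y (conf (Back ks) (Suc h) (tape {..z} s w)) =
      conf (Back ks) h (tape {..z} s w)"
  proof (rule step_conf_read)
    show "move z c0 (Back ks) (x (Suc h)) (y (Suc h)) (tape {..z} s w (int (Suc h))) =
        (Back ks, tape {..z} s w (int (Suc h)), -1)"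
      using assms by (simp add: contents_tape del: tape_int of_nat_Suc)
    show "Back ks \<in> ctrl_states z c0" using assms(1) by (rule ctrl_states_members)
    show "tape {..z} s w (int (Suc h)) \<in> ctrl_symbols A z"
      using assms(2) by (rule tape_symbol) simp
  qed auto
  then show ?case using Suc by - (rule reach_step, simp)
qed

lemma reach_Seek:
  assumes "c # ks \<in> program_stacks c0" "range w \<subseteq> index_symbols" "target z c \<le> z" "h \<le> s (target z c)"
  shows "reach (simulator A z c0) x y (conf (Seek (c # ks)) h (tape {..z} s w))
           (conf (Seek (c # ks)) (s (target z c)) (tape {..z} s w))"
  using assms(4)
proof (induction h rule: inc_induct)
  case base
  show ?case by (rule reach_refl)
next
  case (step h)
  have "Defs.step (simulator A z c0) x y (conf (Seek (c # ks)) h (tape {..z} s w)) =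
      conf (Seek (c # ks)) (Suc h) (tape {..z} s w)"
  proof (rule step_conf_read)
    show "move z c0 (Seek (c # ks)) (x h) (y h) (tape {..z} s w (int h)) =
        (Seek (c # ks), tape {..z} s w (int h), 1)"
      using step.hyps assms(2) by (simp add: contents_tape del: tape_int)
    show "Seek (c # ks) \<in> ctrl_states z c0" using assms(1) by (rule ctrl_states_members)
    show "tape {..z} s w (int h) \<in> ctrl_symbols A z" using assms(2) by (rule tape_symbol) simp
  qed auto
  then show ?case using step.IH by - (rule reach_step, simp)
qed

lemma tape_remove:
  "(tape {..z} s w)(int (s r) := cell (w (s r)) ({r'. r' \<le> z \<and> s r' = s r} - {r})) =
     tape ({..z} - {r}) s w"
proof
  fix i :: int
  show "((tape {..z} s w)(int (s r) := cell (w (s r)) ({r'. r' \<le> z \<and> s r' = s r} - {r}))) i =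
     tape ({..z} - {r}) s w i"
  proof (cases "i = int (s r)")
    case True
    have "{r'. r' \<le> z \<and> s r' = s r} - {r} = {r' \<in> {..z} - {r}. s r' = s r}" by auto
    then show ?thesis using True by simp
  next
    case False
    then have "{r' \<in> {..z}. s r' = nat i} = {r' \<in> {..z} - {r}. s r' = nat i}" if "0 \<le> i"
      using that by auto
    then show ?thesis using False by (simp add: tape_def)
  qed
qed

lemma tape_insert:
  assumes "r \<le> z"
  shows "(tape ({..z} - {r}) s w)(int h := cell (w h) (insert r {r' \<in> {..z} - {r}. s r' = h})) =
     tape {..z} (s(r := h)) w"
proof
  fix i :: int
  show "((tape ({..z} - {r}) s w)(int h := cell (w h) (insert r {r' \<in> {..z} - {r}. s r' = h}))) i =
     tape {..z} (s(r := h)) w i"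
  proof (cases "i = int h")
    case True
    have "insert r {r' \<in> {..z} - {r}. s r' = h} = {r' \<in> {..z}. (s(r := h)) r' = h}"
      using assms by auto
    then show ?thesis using True by (simp only: fun_upd_same tape_int)
  next
    case False
    then have "{r' \<in> {..z} - {r}. s r' = nat i} = {r' \<in> {..z}. (s(r := h)) r' = nat i}" if "0 \<le> i"
      using that by auto
    then show ?thesis using False by (simp add: tape_def)
  qed
qed

text \<open>
  Moving a mark is how a register changes: the head carries the mark of \<open>r\<close> in the
  control state to the cell \<open>h\<close> where it is to be placed.
\<close>

lemma reach_Put:
  assumes "ks \<in> program_stacks c0" "range w \<subseteq> index_symbols" "s z = 0" "r < z"
  shows "reach (simulator A z c0) x y (conf (Put r ks) h (tape ({..z} - {r}) s w))
           (conf (Seek ks) 0 (tape {..z} (s(r := h)) w))"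
proof -
  have w: "w i \<in> index_symbols" for i using assms(2) by auto
  have "Defs.step (simulator A z c0) x y (conf (Put r ks) h (tape ({..z} - {r}) s w)) =
      conf (Back ks) h ((tape ({..z} - {r}) s w)
        (int h := cell (w h) (insert r {r' \<in> {..z} - {r}. s r' = h})))"
    by (rule step_conf) (use assms w in \<open>auto intro!: ctrl_states_members cell_symbol\<close>)
  also have "\<dots> = conf (Back ks) h (tape {..z} (s(r := h)) w)"
    using assms(4) by (subst tape_insert) auto
  finally have "Defs.step (simulator A z c0) x y (conf (Put r ks) h (tape ({..z} - {r}) s w)) =
      conf (Back ks) h (tape {..z} (s(r := h)) w)" .
  moreover have "reach (simulator A z c0) x y (conf (Back ks) h (tape {..z} (s(r := h)) w))
     (conf (Seek ks) 0 (tape {..z} (s(r := h)) w))"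
    using assms by (intro reach_Back) auto
  ultimately show ?thesis by - (rule reach_step, simp)
qed

lemma target_bound:
  assumes "\<And>r. r \<in> registers c0 \<Longrightarrow> r < z" "c # ks \<in> program_stacks c0"
  shows "registers c \<subseteq> {..<z} \<and> target z c \<le> z"
  using stacks_registers[of "c # ks" c0 "[]"] assms by (cases c) (auto intro: less_imp_le)

definition sim_inv :: "nat \<Rightarrow> com \<Rightarrow> com list \<times> (nat \<Rightarrow> nat) \<times> symbol word \<Rightarrow> bool" where
  "sim_inv z c0 C \<longleftrightarrow>
     (case C of (st, s, w) \<Rightarrow> st \<in> program_stacks c0 \<and> s z = 0 \<and> range w \<subseteq> index_symbols)"

definition sim_conf :: "nat \<Rightarrow> com list \<times> (nat \<Rightarrow> nat) \<times> symbol word \<Rightarrow> ctrl config" where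
  "sim_conf z C = (case C of (st, s, w) \<Rightarrow> conf (Seek st) 0 (tape {..z} s w))"

text \<open>
  Every command is executed by the same round trip from the origin. The two kinds of action are
  treated once each: commands that leave the registers alone, and those that move the mark of a
  register to a neighbouring cell.
\<close>

lemma sim_step:
  assumes regs: "\<And>r. r \<in> registers c0 \<Longrightarrow> r < z"
    and ex: "exec x y C C'" and inv: "sim_inv z c0 C"
  shows "sim_inv z c0 C' \<and> reach (simulator A z c0) x y (sim_conf z C) (sim_conf z C')"
proof -
  obtain st s w st' s' w' where C: "C = (st, s, w)" and C': "C' = (st', s', w')"
    by (metis prod_cases3)
  obtain c ks where st: "st = c # ks" using ex C by (auto elim: exec.cases)
  have Q: "c # ks \<in> program_stacks c0" and z: "s z = 0" and w: "range w \<subseteq> index_symbols"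
    using inv by (auto simp: sim_inv_def C st)
  have wi: "w i \<in> index_symbols" for i using w by auto
  have Q': "st' \<in> program_stacks c0"
    using stacks_step[of x y st s w st' s' w' c0 "[]"] ex Q by (auto simp: C C' st)
  have rg: "registers c \<subseteq> {..<z}" "target z c \<le> z" using target_bound[OF regs Q] by auto
  have inv': "sim_inv z c0 C'"
  proof -
    have "range (w(i := Blank)) \<subseteq> index_symbols" for i
      using wi by (auto simp: index_symbols_def)
    then show ?thesis
      using ex Q' z w rg by (auto simp: sim_inv_def C C' st elim!: exec.cases)
  qed
  let ?h = "s (target z c)"
  let ?S = "{r. r \<le> z \<and> s r = ?h}"
  have seek: "reach (simulator A z c0) x y (sim_conf z C) (conf (Seek (c # ks)) ?h (tape {..z} s w))"
    unfolding C sim_conf_def st prod.case by (rule reach_Seek) (use Q w rg in auto)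
  have found: "move z c0 (Seek (c # ks)) (x ?h) (y ?h) (tape {..z} s w (int ?h)) =
      act z c ks (x ?h) (y ?h) (w ?h) ?S"
    using wi rg by simp
  have stay: "reach (simulator A z c0) x y (conf (Seek (c # ks)) ?h (tape {..z} s w)) (sim_conf z C')"
    if "act z c ks (x ?h) (y ?h) (w ?h) ?S = (Back st', cell (w' ?h) ?S, 0)"
      "s' = s" "w' ?h \<in> index_symbols" "\<And>i. i \<noteq> ?h \<Longrightarrow> w' i = w i"
  proof -
    have "Defs.step (simulator A z c0) x y (conf (Seek (c # ks)) ?h (tape {..z} s w)) =
      conf (Back st') ?h ((tape {..z} s w)(int ?h := cell (w' ?h) ?S))"
      by (rule step_conf)
        (use found that Q' in \<open>auto intro!: ctrl_states_members cell_symbol simp del: move.simps\<close>)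
    also have "(tape {..z} s w)(int ?h := cell (w' ?h) ?S) = tape {..z} s w'"
      using that(4) by (auto simp: tape_def fun_eq_iff)
    finally show ?thesis
      using reach_Back[where ks = st' and w = w' and s = s and h = ?h] Q' inv'
      by - (rule reach_step, auto simp: sim_conf_def C' that sim_inv_def)
  qed
  have shift: "reach (simulator A z c0) x y (conf (Seek (c # ks)) ?h (tape {..z} s w)) (sim_conf z C')"
    if "act z c ks (x ?h) (y ?h) (w ?h) ?S = (Put (target z c) st', cell (w ?h) (?S - {target z c}), d)"
      "s' = s(target z c := h')" "int ?h + d = int h'" "w' = w" "target z c < z" for d h'
  proof -
    have "Defs.step (simulator A z c0) x y (conf (Seek (c # ks)) ?h (tape {..z} s w)) =
      conf (Put (target z c) st') h' ((tape {..z} s w)(int ?h := cell (w ?h) (?S - {target z c})))"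
      by (rule step_conf)
        (use found that Q' wi in \<open>auto intro!: ctrl_states_members cell_symbol simp del: move.simps\<close>)
    also have "\<dots> = conf (Put (target z c) st') h' (tape ({..z} - {target z c}) s w)"
      by (simp add: tape_remove)
    finally show ?thesis
      using reach_Put[where ks = st' and w = w and s = s and r = "target z c" and h = h'] Q' w z that
      by - (rule reach_step, auto simp: sim_conf_def C')
  qed
  have "reach (simulator A z c0) x y (conf (Seek (c # ks)) ?h (tape {..z} s w)) (sim_conf z C')"
    using ex[unfolded C C' st]
  proof cases
    case 1
    then show ?thesis using wi by (intro stay) auto
  next
    case (2 r)
    then show ?thesis using rg by (intro shift[of 1]) auto
  next
    case (3 r)
    show ?thesis
    proof (cases "s r = 0")
      case True
      then show ?thesis using 3 z wi by (intro stay) auto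
    next
      case False
      then show ?thesis using 3 rg z by (intro shift[of "-1" "s r - 1"]) auto
    qed
  next
    case (4 r)
    then show ?thesis by (intro stay) (auto simp: index_symbols_def)
  next
    case (5 c1 c2)
    then show ?thesis using wi by (intro stay) auto
  next
    case (6 r t c1 c2)
    then show ?thesis using wi z by (intro stay) auto
  next
    case (7 r c)
    then show ?thesis using wi z by (intro stay) auto
  qed
  then show ?thesis using seek inv' reach_trans by blast
qed

lemma sim_run:
  assumes regs: "\<And>r. r \<in> registers c0 \<Longrightarrow> r < z"
    and run: "(exec x y)\<^sup>*\<^sup>* C C'" and inv: "sim_inv z c0 C"
  shows "sim_inv z c0 C' \<and> reach (simulator A z c0) x y (sim_conf z C) (sim_conf z C')"
  using run
proof (induction rule: rtranclp_induct)
  case base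
  show ?case using inv by (simp add: reach_refl)
next
  case (step C1 C2)
  then show ?case using sim_step[OF regs step.hyps(2)] reach_trans by blast
qed

text \<open>
  When \<open>Halt\<close> is reached with all registers \<open>0\<close>, all marks are in cell \<open>0\<close>, so that writing the
  output there removes them all. The letter of cell \<open>0\<close> disappears in the same way, which is
  why only the other letters of the third word have to be erased beforehand.
\<close>

lemma terminates_with_simulator:
  assumes regs: "\<And>r. r \<in> registers c0 \<Longrightarrow> r < z" and a: "a \<in> A"
    and run: "(exec x y)\<^sup>*\<^sup>* ([c0], \<lambda>_. 0, \<lambda>i. list_tape (binary m) (int i)) (Halt a # ks, \<lambda>_. 0, w)"
    and w: "\<And>i. 0 < i \<Longrightarrow> w i = Blank"
  shows "terminates_with (simulator A z c0) x y m ((\<lambda>_. Blank)(0 := a))"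
proof -
  let ?M = "simulator A z c0"
  define w0 where "w0 = (\<lambda>i::nat. list_tape (binary m) (int i))"
  have "list_tape (binary m) i \<in> index_symbols" for i
  proof (cases "0 \<le> i \<and> nat i < length (binary_digits m)")
    case True
    then have "binary_digits m ! nat i < 2" using binary_digits_less_2[OF nth_mem] by blast
    then show ?thesis
      using True by (auto simp: list_tape_def binary_def index_symbols_def less_2_cases_iff)
  next
    case False
    then show ?thesis by (auto simp: list_tape_def binary_def index_symbols_def)
  qed
  then have w0: "range w0 \<subseteq> index_symbols" by (auto simp: w0_def)
  have st0: "[c0] \<in> stacks c0 []" by (rule stacks_self)
  have inv0: "sim_inv z c0 ([c0], \<lambda>_. 0, w0)"
    using w0 st0 by (simp add: sim_inv_def)
  note sim = sim_run[OF regs run[folded w0_def] inv0]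
  have T0: "init_config ?M m = conf Start 0 (list_tape (binary m))"
    by (simp add: init_config_def conf_def simulator_def)
  have "step ?M x y (init_config ?M m) =
      conf (Seek [c0]) 0 ((list_tape (binary m))(int 0 := cell (w0 0) {..z}))"
    unfolding T0
  proof (rule step_conf)
    show "cell (w0 0) {..z} \<in> ctrl_symbols A z" using w0 by (intro cell_symbol) auto
    show "Seek [c0] \<in> ctrl_states z c0" using st0 by (intro ctrl_states_members) auto
  qed (simp_all add: w0_def)
  also have "(list_tape (binary m))(int 0 := cell (w0 0) {..z}) = tape {..z} (\<lambda>_. 0) w0"
    by (auto simp: fun_eq_iff tape_def w0_def cell_def list_tape_def atMost_def)
  finally have 1: "step ?M x y (init_config ?M m) = sim_conf z ([c0], \<lambda>_. 0, w0)"
    by (simp add: sim_conf_def)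
  have w': "range w \<subseteq> index_symbols" using sim by (simp add: sim_inv_def)
  have "step ?M x y (conf (Seek (Halt a # ks)) 0 (tape {..z} (\<lambda>_. 0) w)) =
      conf Done 0 ((tape {..z} (\<lambda>_. 0) w)(int 0 := a))"
    using w' a by (intro step_conf) (auto simp: tape_def ctrl_symbols_def image_subset_iff intro!: ctrl_states_members)
  also have "(tape {..z} (\<lambda>_. 0) w)(int 0 := a) = (\<lambda>_. Blank)(0 := a)"
    using w by (auto simp: fun_eq_iff tape_def cell_def)
  finally have 2: "step ?M x y (sim_conf z (Halt a # ks, \<lambda>_. 0, w)) = conf Done 0 ((\<lambda>_. Blank)(0 := a))"
    by (simp only: sim_conf_def prod.case)
  have 3: "reach ?M x y (sim_conf z ([c0], \<lambda>_. 0, w0)) (sim_conf z (Halt a # ks, \<lambda>_. 0, w))"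
    using sim ..
  have "reach ?M x y (sim_conf z (Halt a # ks, \<lambda>_. 0, w)) (conf Done 0 ((\<lambda>_. Blank)(0 := a)))"
    by (rule reach_step) (simp only: 2 reach_refl)
  then have "reach ?M x y (init_config ?M m) (conf Done 0 ((\<lambda>_. Blank)(0 := a)))"
    using reach_trans[OF 3] by - (rule reach_step, simp only: 1)
  then obtain n where n: "(step ?M x y ^^ n) (init_config ?M m) = conf Done 0 ((\<lambda>_. Blank)(0 := a))"
    unfolding reach_def ..
  have "terminal ?M = Done" by (simp add: simulator_def)
  then show ?thesis
    unfolding terminates_with_def Let_def by (intro exI[of _ n]) (simp only: n, simp add: conf_def)
qed

text \<open>Any countable type of states will do, because states can be numbered.\<close>

lemma computable_operationI:
  fixes M :: "'q::countable machine"
  assumes X: "encoding A X" "operation_on X F" and M: "machine_over A M" "computes M X F"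
  shows "computable_operation A X F"
proof -
  define N :: "nat machine" where "N = \<lparr>states = to_nat ` states M, initial = to_nat (initial M),
    terminal = to_nat (terminal M), tape_symbols = tape_symbols M,
    delta = (\<lambda>n a b e. map_prod to_nat id (delta M (from_nat n) a b e))\<rparr>"
  define ren :: "'q config \<Rightarrow> nat config" where
    "ren c = \<lparr>state = to_nat (state c), head1 = head1 c, head2 = head2 c, head3 = head3 c,
              tape3 = tape3 c\<rparr>" for c
  have step: "step N x y (ren c) = ren (step M x y c)" for x y c
  proof (cases "delta M (state c) (word_tape x (head1 c)) (word_tape y (head2 c)) (tape3 c (head3 c))")
    case (fields q e d1 d2 d3)
    then show ?thesis by (simp add: step_def N_def ren_def)
  qed
  have steps: "(step N x y ^^ n) (ren c) = ren ((step M x y ^^ n) c)" for x y c n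
    by (induction n) (simp_all add: step)
  have init: "init_config N m = ren (init_config M m)" for m
    by (simp add: init_config_def N_def ren_def)
  have "terminates_with N x y m T" if t: "terminates_with M x y m T" for x y m T
  proof -
    obtain n where "state ((step M x y ^^ n) (init_config M m)) = terminal M"
      "tape3 ((step M x y ^^ n) (init_config M m)) = T"
      using t unfolding terminates_with_def Let_def by blast
    then show ?thesis unfolding terminates_with_def init steps Let_def
      by (intro exI[of _ n]) (simp add: ren_def N_def)
  qed
  then have "computes N X F" using M(2) by (auto simp: computes_def)
  moreover have "machine_over A N"
  proof -
    have "delta N q a b e
        \<in> states N \<times> tape_symbols N \<times> {-1, 0, 1} \<times> {-1, 0, 1} \<times> {-1, 0, 1}"
      if q: "q \<in> states N - {terminal N}"
        and e: "a \<in> tape_symbols N" "b \<in> tape_symbols N" "e \<in> tape_symbols N" for q a b e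
    proof -
      obtain q' where "q = to_nat q'" "q' \<in> states M - {terminal M}"
        using q by (auto simp: N_def)
      moreover from this have "delta M q' a b e
          \<in> states M \<times> tape_symbols M \<times> {-1, 0, 1} \<times> {-1, 0, 1} \<times> {-1, 0, 1}"
        using M(1) e by (simp add: machine_over_def N_def)
      ultimately show ?thesis
        by (cases "delta M q' a b e") (simp add: N_def)
    qed
    then show ?thesis using M(1) by (auto simp: machine_over_def N_def)
  qed
  ultimately show ?thesis using X by (auto simp: computable_operation_def)
qed

section \<open>Functions evaluable by programs\<close>

type_synonym input = "symbol word \<times> symbol word \<times> symbol word"

definition runs :: "input \<Rightarrow> com \<Rightarrow> (nat \<Rightarrow> nat) \<Rightarrow> (nat \<Rightarrow> nat) \<Rightarrow> bool" where
  "runs I c s t \<longleftrightarrow> (case I of (x, y, w) \<Rightarrow> \<forall>ks. (exec x y)\<^sup>*\<^sup>* (c # ks, s, w) (ks, t, w))"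

lemma exec_first: "exec x y C C' \<Longrightarrow> (exec x y)\<^sup>*\<^sup>* C' C'' \<Longrightarrow> (exec x y)\<^sup>*\<^sup>* C C''"
  by (rule converse_rtranclp_into_rtranclp)

lemma runs_Skip: "runs I Skip s s"
  and runs_Inc: "runs I (Inc r) s (s(r := Suc (s r)))"
  and runs_Dec: "runs I (Dec r) s (s(r := s r - 1))"
  unfolding runs_def by (safe; rule r_into_rtranclp; rule exec.intros)+

lemma runs_Seq:
  assumes "runs I c1 s t" "runs I c2 t u"
  shows "runs I (Seq c1 c2) s u"
proof -
  have "(exec x y)\<^sup>*\<^sup>* (Seq c1 c2 # ks, s, w) (ks, u, w)" if I: "I = (x, y, w)" for x y w ks
  proof (rule exec_first)
    show "exec x y (Seq c1 c2 # ks, s, w) (c1 # c2 # ks, s, w)" by (rule exec.intros)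
    show "(exec x y)\<^sup>*\<^sup>* (c1 # c2 # ks, s, w) (ks, u, w)"
      using assms unfolding runs_def I prod.case by (meson rtranclp_trans)
  qed
  then show ?thesis by (auto simp: runs_def)
qed

lemma runs_Cond:
  assumes "runs (x, y, w) (if holds b (x (s r)) (y (s r)) (w (s r)) (s r = 0) then c1 else c2) s t"
  shows "runs (x, y, w) (Cond r b c1 c2) s t"
proof -
  have "(exec x y)\<^sup>*\<^sup>* (Cond r b c1 c2 # ks, s, w) (ks, t, w)" for ks
    using assms unfolding runs_def prod.case by (intro exec_first[OF exec.intros(6)]) blast
  then show ?thesis by (simp add: runs_def)
qed

lemma runs_While_stop:
  assumes "s r = 0" shows "runs I (While r c) s s"
proof -
  have "exec x y (While r c # ks, s, w) (ks, s, w)" for x y w ks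
    using exec.intros(7)[of x y r c ks s w] assms by simp
  then show ?thesis unfolding runs_def by (auto intro!: r_into_rtranclp)
qed

lemma runs_While_step:
  assumes "s r \<noteq> 0" "runs I c s t" "runs I (While r c) t u"
  shows "runs I (While r c) s u"
proof -
  obtain x y w where I: "I = (x, y, w)" by (rule prod_cases3)
  have "(exec x y)\<^sup>*\<^sup>* (While r c # ks, s, w) (ks, u, w)" for ks
  proof (rule exec_first)
    show "exec x y (While r c # ks, s, w) (c # While r c # ks, s, w)"
      using exec.intros(7)[of x y r c ks s w] assms(1) by simp
    show "(exec x y)\<^sup>*\<^sup>* (c # While r c # ks, s, w) (ks, u, w)"
      using assms(2,3) unfolding runs_def I prod.case by (meson rtranclp_trans)
  qed
  then show ?thesis by (simp add: runs_def I)
qed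

text \<open>
  Loops are treated by naming the registers after \<open>j\<close> rounds: all loops below run for a number \<open>N\<close> of
  rounds that is known in advance, so no separate termination argument is needed.
\<close>

lemma runs_While:
  assumes "\<And>j. j < N \<Longrightarrow> S j r \<noteq> 0 \<and> runs I c (S j) (S (Suc j))" "S N r = 0"
  shows "runs I (While r c) (S 0) (S N)"
proof -
  have "runs I (While r c) (S j) (S N)" if "j \<le> N" for j
    using that
  proof (induction j rule: inc_induct)
    case base
    then show ?case using assms(2) by (rule runs_While_stop)
  next
    case (step j)
    then show ?case using assms(1)[of j] runs_While_step by blast
  qed
  then show ?thesis by simp
qed

definition clear :: "nat \<Rightarrow> com" where
  "clear r = While r (Dec r)"

definition transfer :: "nat \<Rightarrow> nat \<Rightarrow> com" where
  "transfer r r' = While r (Seq (Dec r) (Inc r'))"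

lemma runs_clear: "runs I (clear r) s (s(r := 0))"
proof -
  define S where "S j = s(r := s r - j)" for j
  have "runs I (While r (Dec r)) (S 0) (S (s r))"
  proof (rule runs_While)
    fix j assume "j < s r"
    moreover have "runs I (Dec r) (S j) (S (Suc j))"
      using runs_Dec[of I r "S j"] by (simp add: S_def)
    ultimately show "S j r \<noteq> 0 \<and> runs I (Dec r) (S j) (S (Suc j))" by (simp add: S_def)
  qed (simp add: S_def)
  then show ?thesis by (simp add: S_def clear_def)
qed

lemma runs_transfer:
  assumes "r \<noteq> r'"
  shows "runs I (transfer r r') s (s(r := 0, r' := s r' + s r))"
proof -
  define S where "S j = s(r := s r - j, r' := s r' + j)" for j
  have "runs I (While r (Seq (Dec r) (Inc r'))) (S 0) (S (s r))"
  proof (rule runs_While)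
    fix j assume "j < s r"
    moreover have "runs I (Seq (Dec r) (Inc r')) (S j) (S (Suc j))"
    proof -
      have "(S j)(r := S j r - 1, r' := Suc (((S j)(r := S j r - 1)) r')) = S (Suc j)"
        using assms by (auto simp: S_def fun_eq_iff)
      then show ?thesis using runs_Seq[OF runs_Dec[of I r "S j"] runs_Inc[of I r']] by simp
    qed
    ultimately show "S j r \<noteq> 0 \<and> runs I (Seq (Dec r) (Inc r')) (S j) (S (Suc j))"
      using assms by (simp add: S_def)
  qed (use assms in \<open>simp add: S_def\<close>)
  then show ?thesis by (simp add: S_def transfer_def)
qed

lemma runs_Seq_eq: "runs I c1 s t \<Longrightarrow> runs I c2 t u \<Longrightarrow> u = u' \<Longrightarrow> runs I (Seq c1 c2) s u'"
  using runs_Seq by blast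

text \<open>
  Here \<open>'a\<close> is a type of contexts: a context determines the three words and the values of
  the variables in \<open>E\<close>, which are functions of the context. The program may depend on the
  placement \<open>\<rho>\<close> of the variables in registers and on the first free register \<open>k\<close>, but not on the
  context. It finds the registers from \<open>k\<close> onwards empty, puts the result into register \<open>k\<close> and
  restores all others. The registers below \<open>k\<close> that hold no variable may contain
  anything; this is what allows subprograms to run while intermediate results are stored.
\<close>

definition evaluable :: "('a \<Rightarrow> input) \<Rightarrow> ('a \<Rightarrow> nat) set \<Rightarrow> ('a \<Rightarrow> nat) \<Rightarrow> bool" where
  "evaluable I E f \<longleftrightarrow> (\<forall>\<rho> k. (\<forall>g\<in>E. \<rho> g < k) \<longrightarrow>
     (\<exists>c. \<forall>a s. (\<forall>g\<in>E. s (\<rho> g) = g a) \<longrightarrow> (\<forall>i\<ge>k. s i = 0) \<longrightarrow>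
        runs (I a) c s (s(k := f a))))"

lemma evaluableE:
  assumes "evaluable I E f" "\<And>g. g \<in> E \<Longrightarrow> \<rho> g < k"
  obtains c where "\<And>a s. (\<And>g. g \<in> E \<Longrightarrow> s (\<rho> g) = g a) \<Longrightarrow> (\<And>i. k \<le> i \<Longrightarrow> s i = 0) \<Longrightarrow>
    runs (I a) c s (s(k := f a))"
  using assms unfolding evaluable_def by metis

lemma evaluableI:
  assumes "\<And>\<rho> k. (\<And>g. g \<in> E \<Longrightarrow> \<rho> g < k) \<Longrightarrow>
     \<exists>c. \<forall>a s. (\<forall>g\<in>E. s (\<rho> g) = g a) \<longrightarrow> (\<forall>i\<ge>k. s i = 0) \<longrightarrow>
        runs (I a) c s (s(k := f a))"
  shows "evaluable I E f"
  using assms unfolding evaluable_def by blast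

text \<open>
  A register cannot be copied without being emptied, so it is emptied into two others, one of which
  is then used to restore it.
\<close>

lemma evaluable_var:
  assumes "f \<in> E" shows "evaluable I E f"
proof (rule evaluableI)
  fix \<rho> :: "('a \<Rightarrow> nat) \<Rightarrow> nat" and k assume "\<And>g. g \<in> E \<Longrightarrow> \<rho> g < k"
  then have less: "\<rho> f < k" using assms by blast
  define c where "c = Seq (While (\<rho> f) (Seq (Dec (\<rho> f)) (Seq (Inc k) (Inc (Suc k)))))
    (transfer (Suc k) (\<rho> f))"
  have "runs (I a) c s (s(k := f a))"
    if E: "\<forall>g\<in>E. s (\<rho> g) = g a" and s: "\<forall>i\<ge>k. s i = 0" for a s
  proof -
    define S where "S j = s(\<rho> f := f a - j, k := j, Suc k := j)" for j
    have "runs (I a) (While (\<rho> f) (Seq (Dec (\<rho> f)) (Seq (Inc k) (Inc (Suc k))))) (S 0) (S (f a))"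
    proof (rule runs_While)
      fix j assume "j < f a"
      moreover have "runs (I a) (Seq (Dec (\<rho> f)) (Seq (Inc k) (Inc (Suc k)))) (S j) (S (Suc j))"
        by (rule runs_Seq_eq[OF runs_Dec runs_Seq[OF runs_Inc runs_Inc]])
          (use less in \<open>auto simp: S_def fun_eq_iff\<close>)
      ultimately show "S j (\<rho> f) \<noteq> 0 \<and>
          runs (I a) (Seq (Dec (\<rho> f)) (Seq (Inc k) (Inc (Suc k)))) (S j) (S (Suc j))"
        using less by (simp add: S_def)
    qed (use less in \<open>simp add: S_def\<close>)
    then have "runs (I a) c (S 0) ((S (f a))(Suc k := 0, \<rho> f := S (f a) (\<rho> f) + S (f a) (Suc k)))"
      unfolding c_def by (rule runs_Seq) (use less in \<open>simp add: runs_transfer del: fun_upd_apply\<close>)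
    moreover have "S 0 = s" "(S (f a))(Suc k := 0, \<rho> f := S (f a) (\<rho> f) + S (f a) (Suc k)) = s(k := f a)"
      using E s assms less by (auto simp: S_def fun_eq_iff)
    ultimately show ?thesis by simp
  qed
  then show "\<exists>c. \<forall>a s. (\<forall>g\<in>E. s (\<rho> g) = g a) \<longrightarrow> (\<forall>i\<ge>k. s i = 0) \<longrightarrow>
      runs (I a) c s (s(k := f a))" by blast
qed

lemma evaluable_0: "evaluable I E (\<lambda>a. 0)"
proof (rule evaluableI, intro exI allI impI)
  fix \<rho> :: "('a \<Rightarrow> nat) \<Rightarrow> nat" and k a and s :: "nat \<Rightarrow> nat"
  assume "\<forall>i\<ge>k. s i = 0"
  then have "s(k := 0) = s" by auto
  then show "runs (I a) Skip s (s(k := 0))" by (simp add: runs_Skip)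
qed

text \<open>For functions obtained from \<open>f\<close> by one further program that works in place on register \<open>k\<close>.\<close>

lemma evaluable_step:
  assumes f: "evaluable I E f"
    and c': "\<And>k a s. s k = f a \<Longrightarrow> (\<And>i. k < i \<Longrightarrow> s i = 0) \<Longrightarrow> runs (I a) (c' k) s (s(k := g a))"
  shows "evaluable I E g"
proof (rule evaluableI)
  fix \<rho> :: "('a \<Rightarrow> nat) \<Rightarrow> nat" and k assume less: "\<And>g. g \<in> E \<Longrightarrow> \<rho> g < k"
  obtain c where c: "\<And>a s. (\<And>g. g \<in> E \<Longrightarrow> s (\<rho> g) = g a) \<Longrightarrow> (\<And>i. k \<le> i \<Longrightarrow> s i = 0) \<Longrightarrow>
      runs (I a) c s (s(k := f a))"
    using evaluableE[of I E f \<rho> k, OF f less] by blast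
  have "runs (I a) (Seq c (c' k)) s (s(k := g a))"
    if "\<forall>g\<in>E. s (\<rho> g) = g a" "\<forall>i\<ge>k. s i = 0" for a s
    by (rule runs_Seq_eq[OF c c']) (use that in auto)
  then show "\<exists>c. \<forall>a s. (\<forall>g\<in>E. s (\<rho> g) = g a) \<longrightarrow> (\<forall>i\<ge>k. s i = 0) \<longrightarrow>
      runs (I a) c s (s(k := g a))" by blast
qed

lemma evaluable_Suc: "evaluable I E f \<Longrightarrow> evaluable I E (\<lambda>a. Suc (f a))"
  by (erule evaluable_step[where c' = Inc]) (use runs_Inc in metis)

lemma evaluable_pred: "evaluable I E f \<Longrightarrow> evaluable I E (\<lambda>a. f a - 1)"
  by (erule evaluable_step[where c' = Dec]) (use runs_Dec in metis)

lemma evaluable_test: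
  assumes "evaluable I E f"
  shows "evaluable I E (\<lambda>a. of_bool (holds b (fst (I a) (f a)) (fst (snd (I a)) (f a))
    (snd (snd (I a)) (f a)) (f a = 0)))" (is "evaluable I E (\<lambda>a. of_bool (?P a))")
  using assms
proof (rule evaluable_step[where c' = "\<lambda>k. Seq (Cond k b (Inc (Suc k)) Skip)
    (Seq (clear k) (transfer (Suc k) k))"])
  fix k :: nat and a and s :: "nat \<Rightarrow> nat"
  assume s: "s k = f a" "\<And>i. k < i \<Longrightarrow> s i = 0"
  obtain x y w where I: "I a = (x, y, w)" by (rule prod_cases3)
  have "runs (I a) (Cond k b (Inc (Suc k)) Skip) s (s(Suc k := of_bool (?P a)))"
    unfolding I
  proof (rule runs_Cond)
    have "s(Suc k := Suc 0) = s(Suc k := Suc (s (Suc k)))" "s(Suc k := 0) = s" using s by auto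
    then show "runs (x, y, w) (if holds b (x (s k)) (y (s k)) (w (s k)) (s k = 0)
        then Inc (Suc k) else Skip) s (s(Suc k := of_bool (holds b (fst (x, y, w) (f a))
          (fst (snd (x, y, w)) (f a)) (snd (snd (x, y, w)) (f a)) (f a = 0))))"
      by (auto simp: s(1) runs_Skip runs_Inc simp del: fun_upd_apply)
  qed
  then show "runs (I a) (Seq (Cond k b (Inc (Suc k)) Skip)
      (Seq (clear k) (transfer (Suc k) k))) s (s(k := of_bool (?P a)))"
    by (rule runs_Seq_eq[OF _ runs_Seq[OF runs_clear runs_transfer]])
      (use s in \<open>auto simp: fun_eq_iff\<close>)
qed

text \<open>
  Inside a recursion or a search there is one more variable. The context is then a pair of the old
  context and the new value, and the old variables are composed with the first projection.
\<close>

definition push :: "('a \<Rightarrow> nat) set \<Rightarrow> ('a \<times> nat \<Rightarrow> nat) set" where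
  "push E = insert snd ((\<lambda>g b. g (fst b)) ` E)"

text \<open>
  A program for \<open>f\<close> serves in every larger context, with the variables found at the places of their
  counterparts. So quantities computed outside a loop can be computed again in each round.
\<close>

lemma evaluable_lift:
  assumes f: "evaluable I E f" and E': "\<And>g. g \<in> E \<Longrightarrow> (\<lambda>b. g (\<pi> b)) \<in> E'"
  shows "evaluable (\<lambda>b. I (\<pi> b)) E' (\<lambda>b. f (\<pi> b))"
proof (rule evaluableI)
  fix \<rho> :: "('b \<Rightarrow> nat) \<Rightarrow> nat" and k assume "\<And>g. g \<in> E' \<Longrightarrow> \<rho> g < k"
  then have "\<And>g. g \<in> E \<Longrightarrow> \<rho> (\<lambda>b. g (\<pi> b)) < k" using E' by blast
  from evaluableE[of I E f "\<lambda>g. \<rho> (\<lambda>b. g (\<pi> b))" k, OF f this] obtain c where c: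
    "\<And>a s. (\<And>g. g \<in> E \<Longrightarrow> s (\<rho> (\<lambda>b. g (\<pi> b))) = g a) \<Longrightarrow> (\<And>i. k \<le> i \<Longrightarrow> s i = 0) \<Longrightarrow>
      runs (I a) c s (s(k := f a))" by blast
  have "\<forall>b s. (\<forall>g\<in>E'. s (\<rho> g) = g b) \<longrightarrow> (\<forall>i\<ge>k. s i = 0) \<longrightarrow>
      runs (I (\<pi> b)) c s (s(k := f (\<pi> b)))"
    using E' by (intro allI impI c) auto
  then show "\<exists>c. \<forall>b s. (\<forall>g\<in>E'. s (\<rho> g) = g b) \<longrightarrow> (\<forall>i\<ge>k. s i = 0) \<longrightarrow>
      runs (I (\<pi> b)) c s (s(k := f (\<pi> b)))" ..
qed

lemma evaluable_outer:
  "evaluable I E f \<Longrightarrow> evaluable (\<lambda>b. I (fst b)) (push E) (\<lambda>b. f (fst b))"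
  by (erule evaluable_lift) (simp add: push_def)

lemma evaluable_inner: "evaluable I (push E) snd"
  by (rule evaluable_var) (simp add: push_def)

text \<open>
  Register \<open>k\<close> counts the remaining rounds, \<open>k + 1\<close> the completed ones, and \<open>k + 2\<close> holds the value
  so far. The last two hold the two additional variables of the step function.
\<close>

lemma evaluable_rec:
  assumes n: "evaluable I E n" and z: "evaluable I E z"
    and h: "evaluable (\<lambda>b. I (fst (fst b))) (push (push E)) (\<lambda>b. h (fst (fst b)) (snd (fst b)) (snd b))"
  shows "evaluable I E (\<lambda>a. rec_nat (z a) (h a) (n a))"
proof (rule evaluableI)
  fix \<rho> :: "('a \<Rightarrow> nat) \<Rightarrow> nat" and k assume less: "\<And>g. g \<in> E \<Longrightarrow> \<rho> g < k"
  obtain cn where cn: "\<And>a s. (\<And>g. g \<in> E \<Longrightarrow> s (\<rho> g) = g a) \<Longrightarrow> (\<And>i. k \<le> i \<Longrightarrow> s i = 0) \<Longrightarrow>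
      runs (I a) cn s (s(k := n a))"
    using evaluableE[of I E n \<rho> k, OF n less] by blast
  have "\<And>g. g \<in> E \<Longrightarrow> \<rho> g < k + 2" using less by fastforce
  from evaluableE[of I E z \<rho> "k + 2", OF z this] obtain cz where
    cz: "\<And>a s. (\<And>g. g \<in> E \<Longrightarrow> s (\<rho> g) = g a) \<Longrightarrow> (\<And>i. k + 2 \<le> i \<Longrightarrow> s i = 0) \<Longrightarrow>
      runs (I a) cz s (s(k + 2 := z a))" by blast
  define \<rho>' where "\<rho>' u = (if u = snd then k + 2 else if u = (\<lambda>b. snd (fst b)) then k + 1
    else \<rho> (\<lambda>a. u ((a, 0), 0)))" for u :: "('a \<times> nat) \<times> nat \<Rightarrow> nat"
  have "\<And>g. g \<in> push (push E) \<Longrightarrow> \<rho>' g < k + 3"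
    using less by (fastforce simp: push_def \<rho>'_def)
  from evaluableE[of _ _ _ \<rho>' "k + 3", OF h this] obtain ch where
    ch: "\<And>b s. (\<And>g. g \<in> push (push E) \<Longrightarrow> s (\<rho>' g) = g b) \<Longrightarrow> (\<And>i. k + 3 \<le> i \<Longrightarrow> s i = 0) \<Longrightarrow>
      runs (I (fst (fst b))) ch s (s(k + 3 := h (fst (fst b)) (snd (fst b)) (snd b)))" by blast
  define body where "body = Seq (Dec k) (Seq ch (Seq (clear (k + 2))
    (Seq (transfer (k + 3) (k + 2)) (Inc (k + 1)))))"
  define c where "c = Seq cn (Seq cz (Seq (While k body)
    (Seq (clear (k + 1)) (transfer (k + 2) k))))"
  have "runs (I a) c s (s(k := rec_nat (z a) (h a) (n a)))"
    if E: "\<forall>g\<in>E. s (\<rho> g) = g a" and s: "\<forall>i\<ge>k. s i = 0" for a s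
  proof -
    define S where "S j = s(k := n a - j, k + 1 := j, k + 2 := rec_nat (z a) (h a) j)" for j
    have old: "\<rho> g \<noteq> k" "\<rho> g \<noteq> Suc k" "\<rho> g \<noteq> Suc (Suc k)" if "g \<in> E" for g
      using less[OF that] by auto
    have "runs (I a) cn s (s(k := n a))" using E s by (intro cn) auto
    moreover have "runs (I a) cz (s(k := n a)) (S 0)"
    proof -
      have "runs (I a) cz (s(k := n a)) (s(k := n a, k + 2 := z a))"
        using E s old by (intro cz) auto
      moreover have "s(k := n a, k + 2 := z a) = S 0" using s by (auto simp: S_def fun_eq_iff)
      ultimately show ?thesis by simp
    qed
    moreover have "runs (I a) (While k body) (S 0) (S (n a))"
    proof (rule runs_While)
      fix j assume j: "j < n a"
      have "runs (I a) body (S j) (S (Suc j))"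
        unfolding body_def
      proof (rule runs_Seq_eq[OF runs_Dec runs_Seq[OF _ runs_Seq[OF runs_clear
              runs_Seq[OF runs_transfer runs_Inc]]]])
        let ?s = "(S j)(k := S j k - 1)"
        have "runs (I (fst (fst ((a, j), S j (k + 2))))) ch ?s
          (?s(k + 3 := h (fst (fst ((a, j), S j (k + 2)))) (snd (fst ((a, j), S j (k + 2))))
              (snd ((a, j), S j (k + 2)))))"
        proof (rule ch)
          fix g assume "g \<in> push (push E)"
          then consider "g = snd" | "g = (\<lambda>b. snd (fst b))"
            | g' where "g = (\<lambda>b. g' (fst (fst b)))" "g' \<in> E" by (auto simp: push_def)
          moreover have "(\<lambda>b::('a \<times> nat) \<times> nat. snd (fst b)) \<noteq> snd"
            by (auto dest: fun_cong[of _ _ "((undefined, 0), 1)"])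
          ultimately show "?s (\<rho>' g) = g ((a, j), S j (k + 2))"
          proof cases
            case 3
            show ?thesis
            proof (cases "g = snd \<or> g = (\<lambda>b. snd (fst b))")
              case True
              then show ?thesis by (auto simp: \<rho>'_def S_def)
            next
              case False
              then have "\<rho>' g = \<rho> g'" using 3 by (auto simp: \<rho>'_def)
              then show ?thesis using 3 E old[of g'] by (simp add: S_def)
            qed
          qed (auto simp: \<rho>'_def S_def)
        qed (use s in \<open>auto simp: S_def\<close>)
        then show "runs (I a) ch ?s (?s(k + 3 := h a j (S j (k + 2))))" by simp
      qed (use s in \<open>auto simp: S_def fun_eq_iff\<close>)
      then show "S j k \<noteq> 0 \<and> runs (I a) body (S j) (S (Suc j))"
        using j by (simp add: S_def)
    qed (simp add: S_def)
    ultimately show ?thesis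
      unfolding c_def
      by (rule_tac runs_Seq_eq[OF _ runs_Seq[OF _ runs_Seq[OF _ runs_Seq[OF runs_clear runs_transfer]]]])
        (use s in \<open>auto simp: S_def fun_eq_iff\<close>)
  qed
  then show "\<exists>c. \<forall>a s. (\<forall>g\<in>E. s (\<rho> g) = g a) \<longrightarrow> (\<forall>i\<ge>k. s i = 0) \<longrightarrow>
      runs (I a) c s (s(k := rec_nat (z a) (h a) (n a)))" by blast
qed

text \<open>
  Unbounded search is needed because nothing bounds the length of the numeral at
  the beginning of a \<open>p\<close>-adic word in terms of the index.
\<close>

lemma evaluable_search:
  assumes g: "evaluable (\<lambda>b. I (fst b)) (push E) (\<lambda>b. g (fst b) (snd b))"
    and ex: "\<And>a. \<exists>i. g a i = 0"
  shows "evaluable I E (\<lambda>a. LEAST i. g a i = 0)"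
proof (rule evaluableI)
  fix \<rho> :: "('a \<Rightarrow> nat) \<Rightarrow> nat" and k assume less: "\<And>g. g \<in> E \<Longrightarrow> \<rho> g < k"
  define \<rho>' where "\<rho>' u = (if u = snd then k else \<rho> (\<lambda>a. u (a, 0)))"
    for u :: "'a \<times> nat \<Rightarrow> nat"
  have "\<And>g. g \<in> push E \<Longrightarrow> \<rho>' g < k + 1"
    using less by (fastforce simp: push_def \<rho>'_def)
  from evaluableE[of _ _ _ \<rho>' "k + 1", OF g this] obtain cg where
    cg: "\<And>b s. (\<And>u. u \<in> push E \<Longrightarrow> s (\<rho>' u) = u b) \<Longrightarrow> (\<And>i. k + 1 \<le> i \<Longrightarrow> s i = 0) \<Longrightarrow>
      runs (I (fst b)) cg s (s(k + 1 := g (fst b) (snd b)))" by blast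
  define c where "c = Seq cg (While (k + 1) (Seq (clear (k + 1)) (Seq (Inc k) cg)))"
  have "runs (I a) c s (s(k := LEAST i. g a i = 0))"
    if E: "\<forall>g\<in>E. s (\<rho> g) = g a" and s: "\<forall>i\<ge>k. s i = 0" for a s
  proof -
    define S where "S j = s(k := j, k + 1 := g a j)" for j
    define N where "N = (LEAST i. g a i = 0)"
    have N: "g a N = 0" "\<And>j. j < N \<Longrightarrow> g a j \<noteq> 0"
      unfolding N_def using ex[of a] by (auto intro: LeastI_ex dest: not_less_Least)
    have cg': "runs (I a) cg (s(k := j)) (S j)" for j
    proof -
      have "runs (I (fst (a, j))) cg (s(k := j)) ((s(k := j))(k + 1 := g (fst (a, j)) (snd (a, j))))"
      proof (rule cg)
        fix u assume "u \<in> push E"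
        then consider "u = snd" | g' where "u = (\<lambda>b. g' (fst b))" "g' \<in> E" by (auto simp: push_def)
        then show "(s(k := j)) (\<rho>' u) = u (a, j)"
        proof cases
          case 2
          then show ?thesis using E less[of g'] by (cases "u = snd") (auto simp: \<rho>'_def)
        qed (simp add: \<rho>'_def)
      qed (use s in auto)
      then show ?thesis by (simp add: S_def)
    qed
    have "runs (I a) cg s (S 0)"
      using cg'[of 0] s by (metis fun_upd_triv order_refl)
    moreover have "runs (I a) (While (k + 1) (Seq (clear (k + 1)) (Seq (Inc k) cg))) (S 0) (S N)"
    proof (rule runs_While)
      fix j assume "j < N"
      moreover have "runs (I a) (Seq (clear (k + 1)) (Seq (Inc k) cg)) (S j) (S (Suc j))"
      proof (rule runs_Seq[OF runs_clear runs_Seq[OF runs_Inc]])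
        have "(S j)(k + 1 := 0, k := Suc (((S j)(k + 1 := 0)) k)) = s(k := Suc j)"
          using s by (auto simp: S_def fun_eq_iff)
        then show "runs (I a) cg ((S j)(k + 1 := 0, k := Suc (((S j)(k + 1 := 0)) k))) (S (Suc j))"
          using cg' by simp
      qed
      ultimately show "S j (k + 1) \<noteq> 0 \<and>
          runs (I a) (Seq (clear (k + 1)) (Seq (Inc k) cg)) (S j) (S (Suc j))"
        using N by (simp add: S_def)
    qed (use N in \<open>simp add: S_def\<close>)
    ultimately have "runs (I a) c s (S N)"
      unfolding c_def by (rule runs_Seq)
    moreover have "S N = s(k := N)"
      using s N(1) by (auto simp: S_def fun_eq_iff)
    ultimately show ?thesis by (simp add: N_def)
  qed
  then show "\<exists>c. \<forall>a s. (\<forall>g\<in>E. s (\<rho> g) = g a) \<longrightarrow> (\<forall>i\<ge>k. s i = 0) \<longrightarrow>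
      runs (I a) c s (s(k := LEAST i. g a i = 0))" by blast
qed

section \<open>Arithmetic and decidable conditions\<close>

lemma evaluable_const: "evaluable I E (\<lambda>a. n)"
proof (induction n)
  case 0
  show ?case by (rule evaluable_0)
next
  case (Suc n)
  then show ?case by (rule evaluable_Suc)
qed

lemma evaluable_add:
  assumes "evaluable I E f" "evaluable I E g"
  shows "evaluable I E (\<lambda>a. f a + g a)"
proof -
  have "f a + g a = rec_nat (g a) (\<lambda>i r. Suc r) (f a)" for a
  proof -
    have "m + g a = rec_nat (g a) (\<lambda>i r. Suc r) m" for m by (induction m) simp_all
    then show ?thesis .
  qed
  moreover have "evaluable I E (\<lambda>a. rec_nat (g a) (\<lambda>i r. Suc r) (f a))"
    by (intro evaluable_rec assms evaluable_Suc evaluable_inner)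
  ultimately show ?thesis by simp
qed

lemma evaluable_diff:
  assumes "evaluable I E f" "evaluable I E g"
  shows "evaluable I E (\<lambda>a. f a - g a)"
proof -
  have "m - n = rec_nat m (\<lambda>i r. r - 1) n" for m n :: nat
    by (induction n) simp_all
  then have "f a - g a = rec_nat (f a) (\<lambda>i r. r - 1) (g a)" for a .
  moreover have "evaluable I E (\<lambda>a. rec_nat (f a) (\<lambda>i r. r - 1) (g a))"
    by (intro evaluable_rec assms evaluable_pred evaluable_inner)
  ultimately show ?thesis by simp
qed

lemma evaluable_sum:
  assumes "evaluable I E n" "evaluable (\<lambda>b. I (fst b)) (push E) (\<lambda>b. g (fst b) (snd b))"
  shows "evaluable I E (\<lambda>a. \<Sum>i<n a. g a i)"
proof -
  have "(\<Sum>i<m. u i) = rec_nat 0 (\<lambda>i r. r + u i) m" for m :: nat and u :: "nat \<Rightarrow> nat"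
    by (induction m) simp_all
  moreover have "evaluable I E (\<lambda>a. rec_nat 0 (\<lambda>i r. r + g a i) (n a))"
    by (intro evaluable_rec assms(1) evaluable_0 evaluable_add evaluable_inner
        evaluable_outer[OF assms(2)])
  ultimately show ?thesis by simp
qed

lemma evaluable_mult:
  assumes "evaluable I E f" "evaluable I E g"
  shows "evaluable I E (\<lambda>a. f a * g a)"
proof -
  have "evaluable I E (\<lambda>a. \<Sum>i<f a. g a)"
    by (intro evaluable_sum assms evaluable_outer)
  then show ?thesis by simp
qed

lemma evaluable_power:
  assumes "evaluable I E f" "evaluable I E g"
  shows "evaluable I E (\<lambda>a. f a ^ g a)"
proof -
  have "m ^ n = rec_nat 1 (\<lambda>i r. m * r) n" for m n :: nat
    by (induction n) simp_all
  moreover have "evaluable I E (\<lambda>a. rec_nat 1 (\<lambda>i r. f a * r) (g a))"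
    by (intro evaluable_rec assms(2) evaluable_const evaluable_mult evaluable_inner
        evaluable_outer[OF evaluable_outer[OF assms(1)]])
  ultimately show ?thesis by simp
qed

abbreviation decidable :: "('a \<Rightarrow> input) \<Rightarrow> ('a \<Rightarrow> nat) set \<Rightarrow> ('a \<Rightarrow> bool) \<Rightarrow> bool" where
  "decidable I E P \<equiv> evaluable I E (\<lambda>a. of_bool (P a))"

lemma decidable_not:
  assumes "decidable I E P"
  shows "decidable I E (\<lambda>a. \<not> P a)"
proof -
  have "of_bool (\<not> P a) = (1::nat) - of_bool (P a)" for a by simp
  then show ?thesis using assms by (simp only: evaluable_diff evaluable_const)
qed

lemma decidable_and: "decidable I E P \<Longrightarrow> decidable I E Q \<Longrightarrow> decidable I E (\<lambda>a. P a \<and> Q a)"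
  using evaluable_mult by (simp add: of_bool_conj)

lemma decidable_le:
  assumes "evaluable I E f" "evaluable I E g"
  shows "decidable I E (\<lambda>a. f a \<le> g a)"
proof -
  have "of_bool (m \<le> n) = 1 - (m - n)" for m n :: nat by simp
  then show ?thesis using assms by (simp only: evaluable_diff evaluable_const)
qed

lemma decidable_less:
  assumes "evaluable I E f" "evaluable I E g"
  shows "decidable I E (\<lambda>a. f a < g a)"
  using decidable_le[OF evaluable_Suc[OF assms(1)] assms(2)] by (simp add: Suc_le_eq)

lemma decidable_eq:
  assumes "evaluable I E f" "evaluable I E g"
  shows "decidable I E (\<lambda>a. f a = g a)"
  using decidable_and[OF decidable_le[OF assms] decidable_le[OF assms(2,1)]] by (simp add: eq_iff)

lemma evaluable_if:
  assumes "decidable I E P" "evaluable I E f" "evaluable I E g"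
  shows "evaluable I E (\<lambda>a. if P a then f a else g a)"
proof -
  have "(if P a then f a else g a) = of_bool (P a) * f a + of_bool (\<not> P a) * g a" for a by simp
  then show ?thesis
    by (simp only: evaluable_add evaluable_mult decidable_not assms)
qed

lemma evaluable_Least:
  assumes "decidable (\<lambda>b. I (fst b)) (push E) (\<lambda>b. P (fst b) (snd b))" "\<And>a. \<exists>i. P a i"
  shows "evaluable I E (\<lambda>a. LEAST i. P a i)"
  using evaluable_search[OF decidable_not[OF assms(1)]] assms(2) by simp

lemma evaluable_div:
  assumes "evaluable I E f" "evaluable I E g" "\<And>a. 0 < g a"
  shows "evaluable I E (\<lambda>a. f a div g a)"
proof -
  have "m div n = (LEAST q. m < Suc q * n)" if "0 < n" for m n :: nat
  proof (rule Least_equality[symmetric])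
    show "m < Suc (m div n) * n" using dividend_less_div_times[OF that, of m] by simp
    show "m div n \<le> q" if "m < Suc q * n" for q
      using less_mult_imp_div_less[OF that] by simp
  qed
  moreover have "evaluable I E (\<lambda>a. LEAST q. f a < Suc q * g a)"
  proof (rule evaluable_Least)
    show "\<exists>q. f a < Suc q * g a" for a
      using assms(3)[of a] dividend_less_div_times by (metis mult_Suc)
  qed (intro decidable_less evaluable_mult evaluable_Suc evaluable_inner evaluable_outer assms(1,2))
  ultimately show ?thesis using assms(3) by simp
qed

lemma evaluable_mod:
  assumes "evaluable I E f" "evaluable I E g" "\<And>a. 0 < g a"
  shows "evaluable I E (\<lambda>a. f a mod g a)"
  using evaluable_diff[OF assms(1) evaluable_mult[OF evaluable_div[OF assms] assms(2)]]
  by (simp add: minus_div_mult_eq_mod)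

text \<open>
  Substitution for a bound variable. A program for this could store the value of \<open>f\<close> as a new
  variable, but a sum with a single nonzero term does it by the rules at hand.
\<close>

lemma evaluable_apply:
  assumes g: "evaluable (\<lambda>b. I (fst b)) (push E) (\<lambda>b. g (fst b) (snd b))" and f: "evaluable I E f"
  shows "evaluable I E (\<lambda>a. g a (f a))"
proof -
  have "g a (f a) = (\<Sum>i<Suc (f a). of_bool (i = f a) * g a i)" for a by simp
  moreover have "evaluable I E (\<lambda>a. \<Sum>i<Suc (f a). of_bool (i = f a) * g a i)"
    by (intro evaluable_sum evaluable_Suc f evaluable_mult decidable_eq evaluable_inner
        evaluable_outer[OF f] g)
  ultimately show ?thesis by simp
qed

text \<open>
  A function \<open>g\<close> of the basic context and one number can be applied in every context that extends
  the basic one. This makes sequences such as the digits of an operand available under any number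
  of bound variables.
\<close>

lemma evaluable_closed_apply:
  assumes g: "evaluable (\<lambda>b. I (fst b)) (push {}) (\<lambda>b. g (fst b) (snd b))"
    and f: "evaluable (\<lambda>b. I (\<pi> b)) E f"
  shows "evaluable (\<lambda>b. I (\<pi> b)) E (\<lambda>b. g (\<pi> b) (f b))"
proof (rule evaluable_apply[OF _ f])
  show "evaluable (\<lambda>c. I (\<pi> (fst c))) (push E) (\<lambda>c. g (\<pi> (fst c)) (snd c))"
    using evaluable_lift[OF g, of "\<lambda>c. (\<pi> (fst c), snd c)" "push E"] by (simp add: push_def)
qed

lemma evaluable_finite_sum:
  fixes N :: nat
  shows "(\<And>d. d < N \<Longrightarrow> evaluable I E (f d)) \<Longrightarrow> evaluable I E (\<lambda>a. \<Sum>d<N. f d a)"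
proof (induction N)
  case (Suc N)
  then have "evaluable I E (\<lambda>a. (\<Sum>d<N. f d a) + f N a)" by (intro evaluable_add) auto
  then show ?case by simp
qed (simp add: evaluable_0)

section \<open>From evaluable functions to computable operations\<close>

text \<open>Outputs are symbols, results are numbers in register \<open>0\<close>: count down and select from a list.\<close>

primrec emit :: "symbol list \<Rightarrow> com" where
  "emit [] = Skip"
| "emit (e # es) = Cond 0 IsZero (Halt e) (Seq (Dec 0) (emit es))"

lemma exec_emit:
  "s 0 < length es \<Longrightarrow>
     \<exists>ks'. (exec x y)\<^sup>*\<^sup>* (emit es # ks, s, w) (Halt (es ! s 0) # ks', s(0 := 0), w)"
proof (induction es arbitrary: s ks)
  case (Cons e es)
  note cond = exec.intros(6)[of x y 0 IsZero "Halt e" "Seq (Dec 0) (emit es)" ks s w]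
  show ?case
  proof (cases "s 0 = 0")
    case True
    then have "s(0 := 0) = s" by auto
    then show ?thesis using cond True by auto
  next
    case False
    have "exec x y (emit (e # es) # ks, s, w) (Seq (Dec 0) (emit es) # ks, s, w)"
      using cond False by simp
    then have "(exec x y)\<^sup>*\<^sup>* (emit (e # es) # ks, s, w) (emit es # ks, s(0 := s 0 - 1), w)"
      by (rule exec_first, intro exec_first[OF exec.intros(5)] r_into_rtranclp exec.intros(3))
    moreover obtain ks' where "(exec x y)\<^sup>*\<^sup>* (emit es # ks, s(0 := s 0 - 1), w)
        (Halt (es ! (s 0 - 1)) # ks', s(0 := 0), w)"
    proof -
      have "s 0 - 1 < length es" using Cons.prems False by auto
      then show ?thesis
        using Cons.IH[of "s(0 := s 0 - 1)" ks] that by (auto simp del: fun_upd_apply simp: fun_upd_same)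
    qed
    ultimately show ?thesis
      using False by (simp add: nth_Cons' del: fun_upd_apply emit.simps) (blast intro: rtranclp_trans)
  qed
qed simp

definition erase_upto :: com where
  "erase_upto = While 1 (Seq (Erase 1) (Dec 1))"

lemma exec_erase_upto:
  "(exec x y)\<^sup>*\<^sup>* (erase_upto # ks, s, w)
     (ks, s(1 := 0), \<lambda>i. if 0 < i \<and> i \<le> s 1 then Blank else w i)"
proof (induction "s 1" arbitrary: s w)
  case 0
  then have "s(1 := 0) = s" "(\<lambda>i. if 0 < i \<and> i \<le> s 1 then Blank else w i) = w"
    by (auto simp: fun_eq_iff)
  then show ?case
    using exec.intros(7)[of x y 1 "Seq (Erase 1) (Dec 1)" ks s w] 0 by (auto simp: erase_upto_def)
next
  case (Suc n)
  let ?c = "Seq (Erase 1) (Dec 1)" and ?s = "s(1 := n)" and ?w = "w(s 1 := Blank)"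
  have "exec x y (erase_upto # ks, s, w) (?c # erase_upto # ks, s, w)"
    using exec.intros(7)[of x y 1 ?c ks s w] Suc(2) by (simp add: erase_upto_def)
  moreover have "exec x y (Dec 1 # erase_upto # ks, s, ?w) (erase_upto # ks, ?s, ?w)"
    using exec.intros(3)[of x y 1 "erase_upto # ks" s ?w] Suc(2)[symmetric] by simp
  ultimately have "(exec x y)\<^sup>*\<^sup>* (erase_upto # ks, s, w) (erase_upto # ks, ?s, ?w)"
    by - (rule exec_first, assumption,
      intro exec_first[OF exec.intros(5)] exec_first[OF exec.intros(4)] r_into_rtranclp)
  moreover have "(exec x y)\<^sup>*\<^sup>* (erase_upto # ks, ?s, ?w)
      (ks, s(1 := 0), \<lambda>i. if 0 < i \<and> i \<le> s 1 then Blank else w i)"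
  proof -
    have "(\<lambda>i. if 0 < i \<and> i \<le> ?s 1 then Blank else ?w i) =
        (\<lambda>i. if 0 < i \<and> i \<le> s 1 then Blank else w i)" "?s(1 := 0) = s(1 := 0)" "n = ?s 1"
      using Suc(2) by (auto simp: fun_eq_iff)
    then show ?thesis using Suc(1)[of ?s ?w] by metis
  qed
  ultimately show ?case by (rule rtranclp_trans)
qed

definition index_word :: "nat \<Rightarrow> symbol word" where
  "index_word m i = list_tape (binary m) (int i)"

text \<open>
  The machine computes the code of the output letter, then the length of the index in order to
  erase it, and finally selects the letter. The contexts of type \<open>'a\<close> represent the
  inputs; they are used instead of the words themselves so that additional properties
  of the inputs can be built into them.
\<close>

theorem computable_if_evaluable:
  fixes I :: "'a \<Rightarrow> input"
  assumes X: "encoding A X" "operation_on X F" "Blank \<notin> A"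
    and out: "evaluable I {} out" "\<And>a. out a < length es" "set es \<subseteq> A"
    and I: "\<And>a. \<exists>m. snd (snd (I a)) = index_word m"
    and F: "\<And>x y m. x \<in> X \<Longrightarrow> y \<in> X \<Longrightarrow> \<exists>a. I a = (x, y, index_word m) \<and> F x y m = es ! out a"
  shows "computable_operation A X F"
proof -
  define len where "len a = (LEAST i. snd (snd (I a)) i = Blank)" for a
  have blank: "index_word m i = Blank \<longleftrightarrow> length (binary m) \<le> i" for m i
    by (auto simp: index_word_def list_tape_def binary_def)
  have len: "snd (snd (I a)) i = Blank \<longleftrightarrow> len a \<le> i" for a i
  proof -
    obtain m where m: "snd (snd (I a)) = index_word m" using I by blast
    have "len a = length (binary m)"
      unfolding len_def m blank by (rule Least_equality) auto
    then show ?thesis by (simp add: m blank)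
  qed
  have "evaluable I {} len"
    unfolding len_def
    using evaluable_test[of "\<lambda>b. I (fst b)" "push {}" snd "Sym3 Blank"]
    by (intro evaluable_Least) (auto simp: len intro: evaluable_inner)
  moreover define \<rho> :: "('a \<Rightarrow> nat) \<Rightarrow> nat" where "\<rho> = (\<lambda>_. 0)"
  ultimately obtain cl where cl: "\<And>a s. (\<And>i. 1 \<le> i \<Longrightarrow> s i = 0) \<Longrightarrow> runs (I a) cl s (s(1 := len a))"
    using evaluableE[of I "{}" len \<rho> 1] by auto
  obtain co where co: "\<And>a s. (\<And>i. s i = 0) \<Longrightarrow> runs (I a) co s (s(0 := out a))"
    using evaluableE[of I "{}" out \<rho> 0] out(1) by auto
  define c where "c = Seq co (Seq cl (Seq erase_upto (emit es)))"
  have run: "\<exists>ks w'. (exec x y)\<^sup>*\<^sup>* ([c], \<lambda>_. 0, w) (Halt (es ! out a) # ks, \<lambda>_. 0, w') \<and>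
      (\<forall>i>0. w' i = Blank)" if a: "I a = (x, y, w)" for a x y w
  proof -
    let ?s0 = "\<lambda>_::nat. 0::nat" and ?s1 = "(\<lambda>_::nat. 0::nat)(0 := out a)"
      and ?s2 = "(\<lambda>_::nat. 0::nat)(0 := out a, 1 := len a)"
    define w' where "w' i = (if 0 < i \<and> i \<le> len a then Blank else w i)" for i
    have 1: "(exec x y)\<^sup>*\<^sup>* (co # ks, ?s0, w) (ks, ?s1, w)" for ks
      using co[of ?s0 a] by (simp add: runs_def a)
    have 2: "(exec x y)\<^sup>*\<^sup>* (cl # ks, ?s1, w) (ks, ?s2, w)" for ks
      using cl[of ?s1 a] by (simp add: runs_def a)
    have 3: "(exec x y)\<^sup>*\<^sup>* (erase_upto # ks, ?s2, w) (ks, ?s1, w')" for ks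
    proof -
      have s: "?s2(1 := 0) = ?s1" "?s2 1 = len a" by auto
      show ?thesis
        using exec_erase_upto[of x y ks ?s2 w] unfolding s w'_def[abs_def] .
    qed
    have "(exec x y)\<^sup>*\<^sup>* ([c], ?s0, w) ([emit es], ?s1, w')"
      unfolding c_def
      by (rule exec_first[OF exec.intros(5)], rule rtranclp_trans[OF 1],
          rule exec_first[OF exec.intros(5)], rule rtranclp_trans[OF 2],
          rule exec_first[OF exec.intros(5)], rule 3)
    moreover obtain ks where "(exec x y)\<^sup>*\<^sup>* ([emit es], ?s1, w') (Halt (es ! out a) # ks, ?s0, w')"
    proof -
      have "?s1(0 := 0) = ?s0" by auto
      then show ?thesis
        using exec_emit[of ?s1 es x y "[]" w'] out(2)[of a] that by (auto simp del: fun_upd_upd)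
    qed
    moreover have "\<forall>i>0. w' i = Blank"
      using len[of a] by (auto simp: w'_def a)
    ultimately show ?thesis by (meson rtranclp_trans)
  qed
  define z where "z = Suc (Max (insert 0 (registers c)))"
  have z: "r < z" if "r \<in> registers c" for r
    using that by (simp add: z_def less_Suc_eq_le)
  have "computes (simulator A z c) X F"
    unfolding computes_def
  proof (intro ballI allI)
    fix x y m assume "x \<in> X" "y \<in> X"
    then obtain a where a: "I a = (x, y, index_word m)" "F x y m = es ! out a" using F by blast
    obtain ks w' where w': "(exec x y)\<^sup>*\<^sup>* ([c], \<lambda>_. 0, index_word m) (Halt (es ! out a) # ks, \<lambda>_. 0, w')"
      "\<forall>i>0. w' i = Blank" using run[OF a(1)] by blast
    have "es ! out a \<in> A" using out(2,3) by (meson nth_mem subsetD)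
    then show "terminates_with (simulator A z c) x y m ((\<lambda>_. Blank)(0 := F x y m))"
      using terminates_with_simulator[OF z _ w'(1)[unfolded index_word_def[abs_def]]] w'(2)
      unfolding a(2) by blast
  qed
  moreover have "machine_over A (simulator A z c)"
    using X by (intro machine_over_simulator) (auto simp: encoding_def)
  ultimately show ?thesis using X by (intro computable_operationI)
qed

section \<open>Binary numerals\<close>

lemma nth_binary_digits: "i < length (binary_digits n) \<Longrightarrow> binary_digits n ! i = n div 2 ^ i mod 2"
proof (induction n arbitrary: i rule: binary_digits.induct)
  case (1 n)
  show ?case
  proof (cases "n < 2")
    case True
    then show ?thesis using "1.prems" by (simp add: binary_digits.simps[of n])
  next
    case False
    then have eq: "binary_digits n = n mod 2 # binary_digits (n div 2)"
      by (simp add: binary_digits.simps[of n])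
    show ?thesis
    proof (cases i)
      case (Suc j)
      then show ?thesis using "1.IH"[OF False, of j] "1.prems" by (simp add: eq div_mult2_eq)
    qed (simp add: eq)
  qed
qed

lemma sum_binary_digits: "(\<Sum>i<length (binary_digits n). binary_digits n ! i * 2 ^ i) = n"
proof (induction n rule: binary_digits.induct)
  case (1 n)
  show ?case
  proof (cases "n < 2")
    case True
    then show ?thesis by (simp add: binary_digits.simps[of n])
  next
    case False
    then have eq: "binary_digits n = n mod 2 # binary_digits (n div 2)"
      by (simp add: binary_digits.simps[of n])
    have "(\<Sum>i<length (binary_digits n). binary_digits n ! i * 2 ^ i) =
        n mod 2 + 2 * (\<Sum>i<length (binary_digits (n div 2)). binary_digits (n div 2) ! i * 2 ^ i)"
      by (simp add: eq sum.lessThan_Suc_shift sum_distrib_left algebra_simps del: sum.lessThan_Suc)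
    then show ?thesis using "1.IH"[OF False] by simp
  qed
qed

lemma length_binary_digits_le: "length (binary_digits n) \<le> i \<longleftrightarrow> 0 < i \<and> n < 2 ^ i"
proof (induction n arbitrary: i rule: binary_digits.induct)
  case (1 n)
  show ?case
  proof (cases "n < 2")
    case True
    have "n < 2 ^ i" if "0 < i"
      using True that self_le_power[of "2::nat" i] by linarith
    then show ?thesis using True by (auto simp: binary_digits.simps[of n])
  next
    case False
    show ?thesis
    proof (cases i)
      case (Suc j)
      have "n < 2 \<longleftrightarrow> n div 2 < 1" "n < 2 * 2 ^ j \<longleftrightarrow> n div 2 < 2 ^ j" by auto
      then show ?thesis using "1.IH"[OF False, of j] False Suc
        by (cases j) (auto simp: binary_digits.simps[of n])
    qed (use False in \<open>simp add: binary_digits.simps[of n]\<close>)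
  qed
qed

text \<open>The form in which the length of the order of the result is found, by a search.\<close>

lemma length_binary_digits: "length (binary_digits n) = (LEAST i. 0 < i \<and> n < 2 ^ i)"
  unfolding length_binary_digits_le[symmetric] by (rule Least_equality[symmetric]) auto

section \<open>Reading the operands and the index\<close>

definition tracks :: "(input \<Rightarrow> symbol word) set" where
  "tracks = {fst, \<lambda>I. fst (snd I), \<lambda>I. snd (snd I)}"

lemma decidable_symbol:
  assumes "sel \<in> tracks" "evaluable I E f"
  shows "decidable I E (\<lambda>a. sel (I a) (f a) = c)"
  using assms(1) evaluable_test[OF assms(2), of "Sym1 c"] evaluable_test[OF assms(2), of "Sym2 c"]
    evaluable_test[OF assms(2), of "Sym3 c"]
  by (auto simp: tracks_def)

text \<open>
  A program can only compare a letter with a given one, so the value of a digit is put together from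
  finitely many comparisons. Letters other than the digits below \<open>b\<close> get the value \<open>0\<close>.
\<close>

definition digit_value :: "nat \<Rightarrow> symbol \<Rightarrow> nat" where
  "digit_value b s = (\<Sum>d<b. d * of_bool (s = Digit d))"

lemma digit_value [simp]: "d < b \<Longrightarrow> digit_value b (Digit d) = d"
proof -
  assume "d < b"
  have "digit_value b (Digit d) = (\<Sum>e<b. if e = d then d else 0)"
    unfolding digit_value_def by (rule sum.cong) auto
  then show ?thesis using \<open>d < b\<close> by simp
qed

lemma evaluable_digit_value:
  assumes "sel \<in> tracks" "evaluable I E f"
  shows "evaluable I E (\<lambda>a. digit_value b (sel (I a) (f a)))"
  unfolding digit_value_def
  by (intro evaluable_finite_sum evaluable_mult evaluable_const decidable_symbol assms)

definition begins_with :: "nat \<Rightarrow> symbol \<Rightarrow> symbol word \<Rightarrow> bool" where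
  "begins_with n e v \<longleftrightarrow> (\<forall>i<length (binary_digits n). v i = Digit (binary_digits n ! i)) \<and>
     v (length (binary_digits n)) = e"

lemma evaluable_length_prefix:
  assumes "sel \<in> tracks" "\<And>a. begins_with (n a) e (sel (I a))" "e \<notin> range Digit"
  shows "evaluable I {} (\<lambda>a. length (binary_digits (n a)))"
proof -
  have L: "length (binary_digits (n a)) = (LEAST i. sel (I a) i = e)" for a
    by (rule Least_equality[symmetric])
      (use assms(2)[of a] assms(3) in \<open>auto simp: begins_with_def not_less[symmetric]\<close>)
  have "evaluable I {} (\<lambda>a. LEAST i. sel (I a) i = e)"
    by (rule evaluable_Least)
      (use assms(2) in \<open>auto simp: begins_with_def intro!: decidable_symbol assms(1) evaluable_inner\<close>)
  then show ?thesis by (simp add: L)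
qed

text \<open>
  This yields both the orders of the operands, which end with the separator, and the index itself,
  which ends with a blank.
\<close>

lemma evaluable_prefix:
  assumes "sel \<in> tracks" "\<And>a. begins_with (n a) e (sel (I a))" "e \<notin> range Digit"
  shows "evaluable I {} n"
proof -
  have "n a = (\<Sum>i<length (binary_digits (n a)). digit_value 2 (sel (I a) i) * 2 ^ i)" for a
  proof -
    have "digit_value 2 (sel (I a) i) = binary_digits (n a) ! i"
      if "i < length (binary_digits (n a))" for i
      using assms(2)[of a] that binary_digits_less_2[OF nth_mem[OF that]]
      by (simp add: begins_with_def)
    then show ?thesis using sum_binary_digits[of "n a"] by simp
  qed
  moreover have "evaluable I {} (\<lambda>a. \<Sum>i<length (binary_digits (n a)).
      digit_value 2 (sel (I a) i) * 2 ^ i)"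
    by (intro evaluable_sum evaluable_length_prefix[OF assms] evaluable_mult evaluable_power
        evaluable_const evaluable_inner evaluable_digit_value assms(1))
  ultimately show ?thesis by simp
qed

lemma begins_with_index_word: "begins_with m Blank (index_word m)"
  by (auto simp: begins_with_def index_word_def list_tape_def binary_def)

lemma begins_with_padic_word: "begins_with (nat \<bar>pord a\<bar>) Sep (padic_word a)"
  by (auto simp: begins_with_def padic_word_def binary_def conc_def nth_append)

definition mantissa :: "padic \<Rightarrow> nat \<Rightarrow> nat" where
  "mantissa a i = pdigit a (pord a + int i)"

lemma padic_word_mantissa:
  "padic_word a (Suc (length (binary_digits (nat \<bar>pord a\<bar>)) + i)) = Digit (mantissa a i)"
  by (simp add: padic_word_def binary_def conc_def mantissa_def)

lemma evaluable_mantissa: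
  assumes sel: "sel \<in> tracks" "\<And>a. sel (I a) = padic_word (A a)" and A: "\<And>a. A a \<in> Qp p"
  shows "evaluable (\<lambda>b. I (fst b)) (push {}) (\<lambda>b. mantissa (A (fst b)) (snd b))"
proof -
  have "evaluable I {} (\<lambda>a. length (binary_digits (nat \<bar>pord (A a)\<bar>)))"
    using sel begins_with_padic_word by (intro evaluable_length_prefix[where e = Sep]) auto
  then have "evaluable (\<lambda>b. I (fst b)) (push {}) (\<lambda>b. digit_value p (sel (I (fst b))
      (Suc (length (binary_digits (nat \<bar>pord (A (fst b))\<bar>)) + snd b))))"
    by (intro evaluable_digit_value sel(1) evaluable_Suc evaluable_add evaluable_inner)
      (rule evaluable_outer)
  moreover have "mantissa (A a) i < p" for a i
    using A[of a] by (simp add: Qp_def mantissa_def)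
  ultimately show ?thesis by (simp add: sel(2) padic_word_mantissa)
qed

section \<open>The letters of a sum or product\<close>

text \<open>The number of the \<open>m\<close>-th letter of the word of \<open>c\<close> in the list of letters defined next.\<close>

definition letter_code :: "nat \<Rightarrow> padic \<Rightarrow> nat \<Rightarrow> nat" where
  "letter_code p c m = (let k = nat \<bar>pord c\<bar>; l = length (binary_digits k) in
     if m < l then k div 2 ^ m mod 2 else if m = l then p else mantissa c (m - Suc l))"

definition letters :: "nat \<Rightarrow> symbol list" where
  "letters p = map Digit [0..<p] @ [Sep]"

lemma letter_code:
  assumes "c \<in> Qp p" "2 \<le> p"
  shows "letter_code p c m < length (letters p)" "letters p ! letter_code p c m = padic_word c m"
proof -
  define k where "k = nat \<bar>pord c\<bar>"
  define l where "l = length (binary_digits k)"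
  have man: "mantissa c i < p" for i using assms(1) by (simp add: Qp_def mantissa_def)
  consider "m < l" | "m = l" | i where "m = Suc (l + i)"
    by (metis less_imp_Suc_add linorder_neqE_nat)
  then have "letter_code p c m < length (letters p) \<and> letters p ! letter_code p c m = padic_word c m"
  proof cases
    case 1
    then have c: "letter_code p c m = k div 2 ^ m mod 2"
      by (simp add: letter_code_def k_def l_def Let_def)
    have "k div 2 ^ m mod 2 < p" using assms(2) by (meson less_le_trans mod_less_divisor zero_less_numeral)
    moreover have "padic_word c m = Digit (binary_digits k ! m)"
      using begins_with_padic_word[of c] 1 by (simp add: begins_with_def k_def l_def)
    ultimately show ?thesis
      using nth_binary_digits[of m k] 1 unfolding c by (simp add: letters_def nth_append l_def)
  next
    case 2
    then have c: "letter_code p c m = p" by (simp add: letter_code_def k_def l_def Let_def)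
    have "padic_word c m = Sep"
      using begins_with_padic_word[of c] 2 by (simp add: begins_with_def k_def l_def)
    then show ?thesis unfolding c by (simp add: letters_def nth_append)
  next
    case (3 i)
    then have c: "letter_code p c m = mantissa c i"
      by (simp add: letter_code_def k_def l_def Let_def)
    show ?thesis
      using man[of i] padic_word_mantissa[of c i] 3 unfolding c
      by (simp add: letters_def nth_append k_def l_def)
  qed
  then show "letter_code p c m < length (letters p)" "letters p ! letter_code p c m = padic_word c m"
    by auto
qed

text \<open>
  Counted from the position \<open>-K\<close>, below which all digits are \<open>0\<close>, the order is found by a search
  that stops at position \<open>0\<close> at the latest.
\<close>

lemma order_of_digits_eq:
  assumes "\<And>n. n < - int K \<Longrightarrow> d n = 0"
  shows "order_of_digits d = - int K + int (LEAST i. d (- int K + int i) \<noteq> 0 \<or> K \<le> i)"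
proof -
  note props = order_of_digits_props[of "- int K" d, OF assms]
  let ?o = "order_of_digits d"
  have ge: "- int K \<le> ?o"
    using props(3) assms[of ?o] by force
  have "(LEAST i. d (- int K + int i) \<noteq> 0 \<or> K \<le> i) = nat (?o + int K)"
  proof (rule Least_equality)
    show "d (- int K + int (nat (?o + int K))) \<noteq> 0 \<or> K \<le> nat (?o + int K)"
    proof (cases "?o = 0")
      case False
      then show ?thesis using props(3) ge by auto
    qed simp
    fix i assume "d (- int K + int i) \<noteq> 0 \<or> K \<le> i"
    then show "nat (?o + int K) \<le> i"
      using props(1) props(2)[of "- int K + int i"] by force
  qed
  then show ?thesis using ge by simp
qed

lemma carry_rec:
  "carry p k t i = rec_nat 0 (\<lambda>j c. (t (k + int j) + c) div p) i"
  by (induction i) simp_all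

text \<open>
  The part common to both operations: only the unreduced coefficients, counted from their starting
  position, distinguish a sum from a product.
\<close>

lemma evaluable_letter_code:
  assumes "0 < p" and m: "evaluable I {} m" and K: "evaluable I {} K"
    and T: "evaluable (\<lambda>b. I (fst b)) (push {}) (\<lambda>b. t (fst b) (- int (K (fst b)) + int (snd b)))"
  shows "evaluable I {} (\<lambda>a. letter_code p (padic_reduce p (- int (K a)) (t a)) (m a))"
proof -
  define cy where "cy a i = carry p (- int (K a)) (t a) i" for a i
  define D where "D a i = reduced_digits p (- int (K a)) (t a) (- int (K a) + int i)" for a i
  define J where "J a = (LEAST i. \<not> (D a i = 0 \<and> i < K a))" for a
  define u where "u a = K a - J a" for a
  define L where "L a = (LEAST i. 0 < i \<and> u a < 2 ^ i)" for a
  have D_eq: "D a i = (t a (- int (K a) + int i) + cy a i) mod p" for a i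
    by (simp add: D_def reduced_digits_def cy_def)
  have "evaluable (\<lambda>b. I (fst b)) (push {}) (\<lambda>b. cy (fst b) (snd b))"
    unfolding cy_def carry_rec
    by (intro evaluable_rec evaluable_inner evaluable_0 evaluable_div evaluable_add evaluable_const
        assms(1) evaluable_closed_apply[OF T] evaluable_outer)
  then have D: "evaluable (\<lambda>b. I (fst b)) (push {}) (\<lambda>b. D (fst b) (snd b))"
    unfolding D_eq by (intro evaluable_mod evaluable_add T evaluable_const assms(1))
  have J: "evaluable I {} J"
    unfolding J_def
    by (intro evaluable_Least decidable_not decidable_and decidable_eq decidable_less D
        evaluable_const evaluable_inner evaluable_outer K) (auto intro: exI[of _ "K _"])
  have u: "evaluable I {} u" unfolding u_def by (intro evaluable_diff J K)
  have L: "evaluable I {} L"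
    unfolding L_def
  proof (rule evaluable_Least)
    show "\<exists>i. 0 < i \<and> u a < 2 ^ i" for a
      by (rule exI[of _ "Suc (u a)"]) (simp add: less_SucI order.strict_trans[OF less_exp])
  qed (intro decidable_and decidable_less evaluable_const evaluable_inner evaluable_power
      evaluable_outer u)
  have code: "letter_code p (padic_reduce p (- int (K a)) (t a)) (m a) =
      (if m a < L a then u a div 2 ^ m a mod 2 else if m a = L a then p
       else D a (J a + (m a - Suc (L a))))" for a
  proof -
    let ?c = "padic_reduce p (- int (K a)) (t a)"
    have ord: "pord ?c = - int (K a) + int (J a)"
      unfolding padic_reduce_def
      by (simp add: order_of_digits_eq[of "K a"] reduced_digits_def[of _ "- int (K a)"] J_def D_def
          imp_conv_disj not_less)
    have "J a \<le> K a" unfolding J_def by (rule Least_le) simp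
    then have "nat \<bar>pord ?c\<bar> = u a" using ord by (simp add: u_def)
    moreover have "mantissa ?c i = D a (J a + i)" for i
      unfolding mantissa_def ord by (simp add: padic_reduce_def D_def algebra_simps)
    ultimately show ?thesis
      by (simp add: letter_code_def length_binary_digits L_def)
  qed
  show ?thesis
    unfolding code
    by (intro evaluable_if decidable_less decidable_eq evaluable_mod evaluable_div evaluable_power
        evaluable_const evaluable_apply[OF D] evaluable_add evaluable_diff evaluable_Suc m L u J) simp_all
qed

text \<open>Counted from the orders, the coefficients of a product form an ordinary convolution.\<close>

lemma padic_mult_coeff:
  "(\<Sum>i\<in>{pord a..(pord a + pord b + int n) - pord b}. pdigit a i * pdigit b ((pord a + pord b + int n) - i))
    = (\<Sum>i<Suc n. mantissa a i * mantissa b (n - i))"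
proof -
  have "(\<Sum>i<Suc n. mantissa a i * mantissa b (n - i)) =
      (\<Sum>i\<in>(\<lambda>i. pord a + int i) ` {..<Suc n}. pdigit a i * pdigit b ((pord a + pord b + int n) - i))"
    by (subst sum.reindex) (auto simp: inj_on_def mantissa_def of_nat_diff algebra_simps intro!: sum.cong)
  also have "(\<lambda>i. pord a + int i) ` {..<Suc n} = {pord a..(pord a + pord b + int n) - pord b}"
  proof -
    have "i \<in> (\<lambda>i. pord a + int i) ` {..<Suc n}" if "pord a \<le> i" "i \<le> pord a + int n" for i
      using that by (intro image_eqI[of _ _ "nat (i - pord a)"]) auto
    then show ?thesis by auto
  qed
  finally show ?thesis by simp
qed

text \<open>
  The summands may have different orders: the digits of the one with the greater order are preceded
  by zeros when counted from the common starting position.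
\<close>

lemma pdigit_shift:
  assumes "a \<in> Qp p" "nat (- pord a) \<le> K"
  shows "pdigit a (- int K + int i) =
    (if i < K - nat (- pord a) then 0 else mantissa a (i - (K - nat (- pord a))))"
proof -
  have "pord a \<le> 0" using assms(1) by (simp add: Qp_def)
  then have K: "int (K - nat (- pord a)) = int K + pord a" using assms(2) by simp
  show ?thesis
  proof (cases "i < K - nat (- pord a)")
    case True
    then have "- int K + int i < pord a" using K by linarith
    then show ?thesis using assms(1) True by (simp add: Qp_def)
  next
    case False
    then have "int (i - (K - nat (- pord a))) = int i - int (K - nat (- pord a))"
      by (intro of_nat_diff) simp
    then have "pord a + int (i - (K - nat (- pord a))) = - int K + int i"
      using K by linarith
    then have "mantissa a (i - (K - nat (- pord a))) = pdigit a (- int K + int i)"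
      by (simp only: mantissa_def)
    then show ?thesis using False by simp
  qed
qed

lemma
  fixes A B :: "'a \<Rightarrow> padic"
  assumes p: "0 < p"
    and A: "\<And>a. A a \<in> Qp p" "\<And>a. fst (I a) = padic_word (A a)"
    and B: "\<And>a. B a \<in> Qp p" "\<And>a. fst (snd (I a)) = padic_word (B a)"
    and m: "\<And>a. snd (snd (I a)) = index_word (m a)"
  shows evaluable_padic_add: "evaluable I {} (\<lambda>a. letter_code p (padic_add p (A a) (B a)) (m a))"
    and evaluable_padic_mult: "evaluable I {} (\<lambda>a. letter_code p (padic_mult p (A a) (B a)) (m a))"
proof -
  have tracks: "fst \<in> tracks" "(\<lambda>I. fst (snd I)) \<in> tracks" "(\<lambda>I. snd (snd I)) \<in> tracks"
    by (auto simp: tracks_def)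
  define kA kB where "kA a = nat (- pord (A a))" and "kB a = nat (- pord (B a))" for a
  have oA: "pord (A a) = - int (kA a)" and oB: "pord (B a) = - int (kB a)" for a
    using A(1)[of a] B(1)[of a] by (simp_all add: Qp_def kA_def kB_def)
  have "begins_with (kA a) Sep (padic_word (A a))" "begins_with (kB a) Sep (padic_word (B a))" for a
    using begins_with_padic_word[of "A a"] begins_with_padic_word[of "B a"] by (simp_all add: oA oB)
  then have kA: "evaluable I {} kA" and kB: "evaluable I {} kB"
    unfolding A(2)[symmetric] B(2)[symmetric]
    using evaluable_prefix[OF tracks(1), of kA Sep I] evaluable_prefix[OF tracks(2), of kB Sep I]
    by auto
  have m': "evaluable I {} m"
    by (rule evaluable_prefix[OF tracks(3), of _ Blank]) (auto simp: m begins_with_index_word)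
  have X: "evaluable (\<lambda>b. I (fst b)) (push {}) (\<lambda>b. mantissa (A (fst b)) (snd b))"
    by (rule evaluable_mantissa[OF tracks(1) A(2,1)])
  have Y: "evaluable (\<lambda>b. I (fst b)) (push {}) (\<lambda>b. mantissa (B (fst b)) (snd b))"
    by (rule evaluable_mantissa[OF tracks(2) B(2,1)])
  \<comment> \<open>with truncated subtraction this is the maximum\<close>
  define K where "K a = kA a + (kB a - kA a)" for a
  have K: "evaluable I {} K" unfolding K_def by (intro evaluable_add evaluable_diff kA kB)
  have "padic_add p (A a) (B a) =
      padic_reduce p (- int (K a)) (\<lambda>n. pdigit (A a) n + pdigit (B a) n)" for a
    by (auto simp: padic_add_def oA oB K_def min_def)
  moreover have "evaluable (\<lambda>b. I (fst b)) (push {}) (\<lambda>b. pdigit (A (fst b)) (- int (K (fst b)) + int (snd b))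
      + pdigit (B (fst b)) (- int (K (fst b)) + int (snd b)))"
  proof -
    have "pdigit (A a) (- int (K a) + int i) =
        (if i < K a - kA a then 0 else mantissa (A a) (i - (K a - kA a)))"
      "pdigit (B a) (- int (K a) + int i) =
        (if i < K a - kB a then 0 else mantissa (B a) (i - (K a - kB a)))" for a i
      unfolding kA_def kB_def
      by (rule pdigit_shift[OF A(1)] pdigit_shift[OF B(1)]; simp add: K_def kA_def kB_def)+
    moreover have "evaluable (\<lambda>b. I (fst b)) (push {}) (\<lambda>b.
        (if snd b < K (fst b) - kA (fst b) then 0 else mantissa (A (fst b)) (snd b - (K (fst b) - kA (fst b))))
      + (if snd b < K (fst b) - kB (fst b) then 0 else mantissa (B (fst b)) (snd b - (K (fst b) - kB (fst b)))))"
      by (intro evaluable_add evaluable_if decidable_less evaluable_diff evaluable_inner evaluable_0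
          evaluable_outer[OF K] evaluable_outer[OF kA] evaluable_outer[OF kB]
          evaluable_closed_apply[OF X] evaluable_closed_apply[OF Y])
    ultimately show ?thesis by simp
  qed
  ultimately show "evaluable I {} (\<lambda>a. letter_code p (padic_add p (A a) (B a)) (m a))"
    using evaluable_letter_code[OF p m' K, of "\<lambda>a n. pdigit (A a) n + pdigit (B a) n"] by simp
  define t where "t a n = (\<Sum>i\<in>{pord (A a)..n - pord (B a)}. pdigit (A a) i * pdigit (B a) (n - i))" for a n
  define K' where "K' a = kA a + kB a" for a
  have K': "evaluable I {} K'" unfolding K'_def by (intro evaluable_add kA kB)
  have o: "pord (A a) + pord (B a) = - int (K' a)" for a by (simp add: oA oB K'_def)
  have "padic_mult p (A a) (B a) = padic_reduce p (- int (K' a)) (t a)" for a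
    unfolding padic_mult_def o t_def[abs_def] ..
  moreover have "evaluable (\<lambda>b. I (fst b)) (push {}) (\<lambda>b. t (fst b) (- int (K' (fst b)) + int (snd b)))"
    unfolding t_def o[symmetric] padic_mult_coeff
    by (intro evaluable_sum evaluable_Suc evaluable_inner evaluable_mult evaluable_closed_apply[OF X]
        evaluable_closed_apply[OF Y] evaluable_diff evaluable_outer)
  ultimately show "evaluable I {} (\<lambda>a. letter_code p (padic_mult p (A a) (B a)) (m a))"
    using evaluable_letter_code[OF p m' K', of t] by simp
qed

lemma computable_transport:
  assumes p: "2 \<le> p" and op: "operation_on (Xp p) (transport p f)"
    and f: "\<And>a b. f a b \<in> Qp p"
    and ev: "\<And>A B m. (\<And>a. A a \<in> Qp p) \<Longrightarrow> (\<And>a. B a \<in> Qp p) \<Longrightarrow>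
      evaluable (\<lambda>a :: padic \<times> padic \<times> nat. (padic_word (A a), padic_word (B a), index_word (m a))) {}
        (\<lambda>a. letter_code p (f (A a) (B a)) (m a))"
  shows "computable_operation (padic_alphabet p) (Xp p) (transport p f)"
proof -
  \<comment> \<open>Contexts form a whole type, so arguments outside \<open>Qp p\<close> are replaced by some element of it,
    for which any value of \<open>f\<close> will do.\<close>
  define c where "c a = (if a \<in> Qp p then a else f a a)" for a
  have c: "c a \<in> Qp p" for a by (simp add: c_def f)
  show ?thesis
  proof (rule computable_if_evaluable)
    show "encoding (padic_alphabet p) (Xp p)" using p by (rule encoding_Xp)
    show "Blank \<notin> padic_alphabet p" by (auto simp: padic_alphabet_def)
    show "set (letters p) \<subseteq> padic_alphabet p" by (auto simp: padic_alphabet_def letters_def)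
    show "evaluable (\<lambda>a. (padic_word (c (fst a)), padic_word (c (fst (snd a))), index_word (snd (snd a)))) {}
        (\<lambda>a. letter_code p (f (c (fst a)) (c (fst (snd a)))) (snd (snd a)))"
      by (rule ev) (rule c)+
    show "letter_code p (f (c (fst a)) (c (fst (snd a)))) (snd (snd a)) < length (letters p)" for a
      using f p by (rule letter_code)
    fix x y m assume "x \<in> Xp p" "y \<in> Xp p"
    then obtain a b where ab: "a \<in> Qp p" "b \<in> Qp p" "x = padic_word a" "y = padic_word b"
      by (auto simp: Xp_def)
    then have "transport p f x y m = letters p ! letter_code p (f a b) m"
      by (simp add: transport_def inv_into_f_f[OF inj_on_padic_word] letter_code(2)[OF f p])
    then show "\<exists>a. (padic_word (c (fst a)), padic_word (c (fst (snd a))), index_word (snd (snd a)))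
        = (x, y, index_word m) \<and>
        transport p f x y m = letters p ! letter_code p (f (c (fst a)) (c (fst (snd a)))) (snd (snd a))"
      using ab by (intro exI[of _ "(a, b, m)"]) (simp add: c_def)
  qed (use op in auto)
qed

theorem theorem4p2:
  fixes p :: nat
  assumes "prime p"
  shows "computable_operation (padic_alphabet p) (Xp p) (transport p (padic_add p)) \<and>
         computable_operation (padic_alphabet p) (Xp p) (transport p (padic_mult p))"
proof -
  have p: "2 \<le> p" "0 < p" using prime_ge_2_nat[OF assms] by auto
  show ?thesis
    by (intro conjI computable_transport p operation_on_Xp padic_add_in_Qp padic_mult_in_Qp
        evaluable_padic_add evaluable_padic_mult) auto
qed

end
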